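(* Let $\rho:\mathbb{R}^n\to[0,\infty]$ be radial with $\rho(x)<\infty$ for all $x\neq 0$, $\rho\in L^1_{\mathrm{loc}}(\mathbb{R}^n)$, $\int_{\mathbb{R}^n}\min\{1,|x|^{-1}\}\rho(x)\,dx<\infty$, and $\inf_{B_\varepsilon}\rho>0$ for some $\varepsilon>0$. Then the following two statements hold. (i) For every $u\in C_c^\infty(\mathbb{R}^n)$ we have $\mathcal{G}_\rho u\in C^\infty(\mathbb{R}^n,\mathbb{R}^n)$ and $$\mathcal{G}_\rho u = Q_\rho * \nabla u=\nabla(Q_\rho * u).$$ (ii) If, in addition, $\rho\in L^1(\mathbb{R}^n)$, then for every $u\in C_c^\infty(\mathbb{R}^n)$ $$\widehat{\mathcal{G}_\rho u}(\xi)=2\pi i\xi\,\widehat{Q}_\rho(\xi)\,\widehat{u}(\xi)\quad\text{and}\quad \lambda_\rho(\xi)=2\pi i\xi\,\widehat{Q}_\rho(\xi)\qquad\text{for all }\xi\in\mathbb{R}^n,$$ and $$\widehat{Q}_\rho(\xi)=\frac{1}{2\pi|\xi|}\int_{\mathbb{R}^n}\frac{\rho(x)x_1}{|x|^2}\sin(2\pi|\xi|x_1)\,dx\qquad\text{for all }\xi\in\mathbb{R}^n\setminus\{0\}.$$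
   Context: Here $n\in\mathbb{N}$, $n\geq 1$, and $B_r$ is the open ball of radius $r$ centred at $0$ in $\mathbb{R}^n$. Radial means $\rho(x)=\overline{\rho}(|x|)$ for all $x$, for a function $\overline{\rho}$ on $[0,\infty)$ (the radial representation). The Fourier transform is $\widehat{f}(\xi)=\int_{\mathbb{R}^n}f(x)e^{-2\pi i x\cdot\xi}\,dx$. For $u\in C_c^\infty(\mathbb{R}^n)$ (real-valued), the nonlocal gradient is $$\mathcal{G}_\rho u(x)=\int_{\mathbb{R}^n}\frac{u(x)-u(y)}{|x-y|}\frac{x-y}{|x-y|}\rho(x-y)\,dy,\qquad x\in\mathbb{R}^n,$$ an absolutely convergent integral. Moreover $$Q_\rho(x)=\int_{|x|}^\infty\frac{\overline{\rho}(t)}{t}\,dt,\quad x\in\mathbb{R}^n\setminus\{0\},\qquad \lambda_\rho(\xi)=\int_{\mathbb{R}^n}\frac{\rho(x)x}{|x|^2}\left(e^{2\pi i\xi\cdot x}-1\right)dx,\quad \xi\in\mathbb{R}^n.$$ Under the hypotheses on $\rho$, $Q_\rho$ is finite and lies in $L^1_{\mathrm{loc}}(\mathbb{R}^n)$, and $Q_\rho\in L^1(\mathbb{R}^n)$ if $\rho\in L^1(\mathbb{R}^n)$. *)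

theory Defs
  imports "HOL-Analysis.Analysis"
begin

section \<open>Kernels\<close>

text \<open>Kernels take values in \<open>[0,\<infinity>]\<close>. They are finite away from the origin, so \<open>enn2real\<close>
  changes them at most at \<open>0\<close>, where every integrand below vanishes or the point is negligible.
  Measurability is with respect to Lebesgue measurable sets.\<close>

definition radial_rep :: "(real^'n \<Rightarrow> ennreal) \<Rightarrow> (real \<Rightarrow> ennreal) \<Rightarrow> bool" where
  "radial_rep \<rho> \<rho>b \<longleftrightarrow> (\<forall>x. \<rho> x = \<rho>b (norm x))"

definition L1 :: "(real^'n \<Rightarrow> ennreal) \<Rightarrow> bool" where
  "L1 \<rho> \<longleftrightarrow> \<rho> \<in> borel_measurable lebesgue \<and> (\<integral>\<^sup>+x. \<rho> x \<partial>lebesgue) < \<infinity>"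

definition L1_loc :: "(real^'n \<Rightarrow> ennreal) \<Rightarrow> bool" where
  "L1_loc \<rho> \<longleftrightarrow> \<rho> \<in> borel_measurable lebesgue \<and>
     (\<forall>K. compact K \<longrightarrow> (\<integral>\<^sup>+x\<in>K. \<rho> x \<partial>lebesgue) < \<infinity>)"

section \<open>Smooth functions\<close>

primrec C_diff :: "nat \<Rightarrow> (real^'n \<Rightarrow> 'b::real_normed_vector) \<Rightarrow> bool" where
  "C_diff 0 f \<longleftrightarrow> continuous_on UNIV f"
| "C_diff (Suc k) f \<longleftrightarrow> (\<forall>x. f differentiable (at x)) \<and>
     (\<forall>i. C_diff k (\<lambda>x. frechet_derivative f (at x) (axis i 1)))"

definition C_inf :: "(real^'n \<Rightarrow> 'b::real_normed_vector) \<Rightarrow> bool" where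
  "C_inf f \<longleftrightarrow> (\<forall>k. C_diff k f)"

definition C_inf_c :: "(real^'n \<Rightarrow> real) \<Rightarrow> bool" where
  "C_inf_c u \<longleftrightarrow> C_inf u \<and> compact (closure {x. u x \<noteq> 0})"

definition grad :: "(real^'n \<Rightarrow> real) \<Rightarrow> real^'n \<Rightarrow> real^'n" where
  "grad f x = (\<chi> i. frechet_derivative f (at x) (axis i 1))"

section \<open>Convolution and Fourier transform\<close>

definition conv ::
    "(real^'n \<Rightarrow> real) \<Rightarrow> (real^'n \<Rightarrow> 'b::euclidean_space) \<Rightarrow> real^'n \<Rightarrow> 'b" where
  "conv f g x = (LINT y|lebesgue. f (x - y) *\<^sub>R g y)"

definition fourier :: "(real^'n \<Rightarrow> real) \<Rightarrow> real^'n \<Rightarrow> complex" where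
  "fourier f \<xi> =
     (LINT x|lebesgue. complex_of_real (f x) * exp (- (2 * pi * \<i> * complex_of_real (x \<bullet> \<xi>))))"

definition fourier_vec :: "(real^'n \<Rightarrow> real^'n) \<Rightarrow> real^'n \<Rightarrow> complex^'n" where
  "fourier_vec F \<xi> = (\<chi> i. fourier (\<lambda>x. F x $ i) \<xi>)"

definition cvec :: "real^'n \<Rightarrow> complex^'n" where
  "cvec v = (\<chi> i. complex_of_real (v $ i))"

section \<open>Nonlocal gradient and associated kernels\<close>

text \<open>The integrand is \<open>0\<close> at \<open>y = x\<close> because division by zero yields zero.\<close>

definition nl_grad :: "(real^'n \<Rightarrow> ennreal) \<Rightarrow> (real^'n \<Rightarrow> real) \<Rightarrow> real^'n \<Rightarrow> real^'n" where
  "nl_grad \<rho> u x =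
     (LINT y|lebesgue. ((u x - u y) / norm (x - y)) *\<^sub>R
        (enn2real (\<rho> (x - y)) *\<^sub>R ((x - y) /\<^sub>R norm (x - y))))"

text \<open>\<open>Q_ker\<close> depends on the kernel only through its radial representation on \<open>(0,\<infinity>)\<close>;
  its value at \<open>0\<close> carries no meaning.\<close>

definition Q_ker :: "(real \<Rightarrow> ennreal) \<Rightarrow> real^'n \<Rightarrow> real" where
  "Q_ker \<rho>b x = (LINT t:{norm x<..}|lebesgue. enn2real (\<rho>b t) / t)"

definition lam :: "(real^'n \<Rightarrow> ennreal) \<Rightarrow> real^'n \<Rightarrow> complex^'n" where
  "lam \<rho> \<xi> =
     (LINT x|lebesgue. (exp (2 * pi * \<i> * complex_of_real (\<xi> \<bullet> x)) - 1) *s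
        cvec ((enn2real (\<rho> x) / (norm x)\<^sup>2) *\<^sub>R x))"

end

theory Submission
  imports Defs
begin

text \<open>The whole proposition rests on one integration by parts that is carried out along straight lines. Let
  \<open>p\<close> be the radial profile of the kernel, let \<open>Q z\<close> be the integral of \<open>p t / t\<close> over \<open>t > |z|\<close>, and for a
  unit vector \<open>e\<close> put \<open>K w = p |w| (w \<bullet> e) / |w|\<^sup>2\<close>. Formally \<open>- K\<close> is the derivative of \<open>Q\<close> in
  direction \<open>e\<close>. In integrated form this says that \<open>Q z\<close> is the integral of \<open>K (z + s e)\<close> over
  \<open>s > 0\<close> whenever \<open>z \<bullet> e > 0\<close>; it is the substitution \<open>t = |z + s e|\<close> (lemma
  \<open>tail_eq_line_integral\<close>). Now let \<open>h\<close> be the derivative of \<open>v\<close> in direction \<open>e\<close>. Fubini's theorem and the shear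
  \<open>z = w - s e\<close> turn the integral of \<open>Q h\<close> over the half space \<open>z \<bullet> e > 0\<close> into the integral of
  \<open>K w\<close> times the integral of \<open>h\<close> over the segment from the foot of the perpendicular of \<open>w\<close> on
  the hyperplane \<open>e \<bullet> z = 0\<close> to \<open>w\<close>, that is, times \<open>v w - v w'\<close> with \<open>w'\<close> the foot. The other
  half space is the same statement for \<open>- e\<close>. Since \<open>w\<close> and its mirror image have the same foot and
  \<open>K\<close> is odd under the reflection, \<open>v w'\<close> may be replaced by the constant \<open>v 0\<close>, and
  \<open>(\<integral>z. Q z * h z) = (\<integral>w. K w * (v w - v 0))\<close>
  results (lemma \<open>kernel_integral_by_parts\<close>).

  The identities of the proposition are instances. The choice \<open>v z = - u (x - z)\<close> gives the convolution
  formula for the nonlocal gradient, \<open>v z = exp (2 \<pi> i \<xi> \<bullet> z)\<close> gives the formula for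
  \<open>lam\<close>, and \<open>v z = sin (2 \<pi> |\<xi>| z\<^sub>k) / (2 \<pi> |\<xi>|)\<close> gives the formula for the Fourier transform of \<open>Q\<close>,
  once rotation invariance has replaced \<open>\<xi>\<close> by a multiple of a coordinate vector. Smoothness and the identity
  with the gradient of the convolution follow by differentiating under the integral, because
  \<open>Q\<close> is locally integrable (lemmas \<open>conv_has_derivative\<close> and \<open>conv_C_inf\<close>). The Fourier transform of the
  nonlocal gradient is computed by applying Fubini's theorem to \<open>K w (u x - u (x - w))\<close>, which
  produces \<open>lam\<close> times the transform of \<open>u\<close>.

  One point of measure theory remains. The kernel is only Lebesgue measurable on the
  whole space, whereas \<open>Q\<close> is a one-dimensional integral of the profile. Lemma \<open>radial_profile\<close>
  supplies a Borel profile that agrees with the kernel at almost every point of the space and with the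
  radial representation at almost every radius, and everything above is carried out for Borel profiles.\<close>

section \<open>Isometries and shears preserve Lebesgue measure\<close>

lemma lborel_distr_reflect:
  fixes a :: "'a::euclidean_space"
  shows "distr lborel borel (\<lambda>x. a - x) = lborel"
  using lborel_affine[of "-1" a] by (simp add: density_1)

lemma nn_integral_lborel_reflect:
  fixes a :: "'a::euclidean_space"
  assumes [measurable]: "f \<in> borel_measurable borel"
  shows "(\<integral>\<^sup>+x. f (a - x) \<partial>lborel) = (\<integral>\<^sup>+x. f x \<partial>lborel)"
  by (subst (2) lborel_distr_reflect[of a, symmetric]) (simp add: nn_integral_distr)

lemma nn_integral_lborel_translate:
  fixes a :: "'a::euclidean_space"
  assumes [measurable]: "f \<in> borel_measurable borel"
  shows "(\<integral>\<^sup>+x. f (a + x) \<partial>lborel) = (\<integral>\<^sup>+x. f x \<partial>lborel)"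
  by (subst (2) lborel_distr_plus[of a, symmetric]) (simp add: nn_integral_distr)

lemma orthogonal_transformation_borel_measurable:
  fixes T :: "'a::euclidean_space \<Rightarrow> 'a"
  assumes "orthogonal_transformation T"
  shows "T \<in> borel_measurable borel"
  using assms by (intro borel_measurable_continuous_onI linear_continuous_on
      orthogonal_transformation_linear[THEN linear_linear[THEN iffD2]])

text \<open>The image of Lebesgue measure under \<open>T\<close> is translation invariant, and any two nonzero, locally finite,
  translation invariant measures are proportional: convolving with the indicator of a ball and exchanging the order of
  integration compares them. The unit ball is fixed by \<open>T\<close>, which makes the factor of proportionality one.\<close>
lemma nn_integral_lborel_orthogonal:
  fixes T :: "'a::euclidean_space \<Rightarrow> 'a"
  assumes T: "orthogonal_transformation T" and [measurable]: "f \<in> borel_measurable borel"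
  shows "(\<integral>\<^sup>+x. f (T x) \<partial>lborel) = (\<integral>\<^sup>+x. f x \<partial>lborel)"
proof -
  note [measurable] = orthogonal_transformation_borel_measurable[OF T]
  have lin: "linear T" using T by (rule orthogonal_transformation_linear)
  obtain S where TS: "T (S x) = x" for x
    using orthogonal_transformation_surj[OF T] by (metis surjD)
  have add: "T (x + y) = T x + T y" for x y using lin by (rule linear_add)
  define b :: "'a \<Rightarrow> ennreal" where "b = indicator (ball 0 1)"
  have [measurable]: "b \<in> borel_measurable borel"
    unfolding b_def by (intro borel_measurable_indicator borel_open) simp
  have shift: "(\<integral>\<^sup>+y. g (T y - x) \<partial>lborel) = (\<integral>\<^sup>+y. g (T y) \<partial>lborel)"
    if [measurable]: "g \<in> borel_measurable borel" for g :: "'a \<Rightarrow> ennreal" and x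
    using nn_integral_lborel_translate[of "\<lambda>y. g (T y)" "- S x"]
    by (simp add: add linear_diff[OF lin] TS)
  have "(\<integral>\<^sup>+x. b x \<partial>lborel) * (\<integral>\<^sup>+y. f (T y) \<partial>lborel)
      = (\<integral>\<^sup>+x. \<integral>\<^sup>+y. b x * f (T y - x) \<partial>lborel \<partial>lborel)"
    by (simp add: shift nn_integral_cmult nn_integral_multc)
  also have "\<dots> = (\<integral>\<^sup>+y. \<integral>\<^sup>+x. b x * f (T y - x) \<partial>lborel \<partial>lborel)"
    by (rule lborel_pair.Fubini') measurable
  also have "\<dots> = (\<integral>\<^sup>+y. \<integral>\<^sup>+x. b (T y - x) * f x \<partial>lborel \<partial>lborel)"
    using nn_integral_lborel_reflect[of "\<lambda>x. b x * f (T y - x)" "T y" for y]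
    by (simp cong: nn_integral_cong)
  also have "\<dots> = (\<integral>\<^sup>+x. \<integral>\<^sup>+y. b (T y - x) * f x \<partial>lborel \<partial>lborel)"
    by (rule lborel_pair.Fubini') measurable
  also have "\<dots> = (\<integral>\<^sup>+y. b (T y) \<partial>lborel) * (\<integral>\<^sup>+x. f x \<partial>lborel)"
    by (simp add: shift nn_integral_cmult nn_integral_multc)
  also have "(\<lambda>y. b (T y)) = b"
    by (auto simp: b_def indicator_def orthogonal_transformation_norm[OF T])
  finally have eq: "emeasure lborel (ball (0::'a) 1) * (\<integral>\<^sup>+y. f (T y) \<partial>lborel)
      = emeasure lborel (ball (0::'a) 1) * (\<integral>\<^sup>+x. f x \<partial>lborel)"
    by (simp add: b_def)
  have "emeasure lborel (ball (0::'a) 1) \<noteq> 0"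
    using open_not_negligible[of "ball (0::'a) 1"] negligible_iff_emeasure0[of "ball (0::'a) 1"]
    by (auto simp: main_part_sets)
  moreover have "emeasure lborel (ball (0::'a) 1) \<noteq> \<infinity>"
    using emeasure_bounded_finite[of "ball (0::'a) 1"] by simp
  ultimately show ?thesis using eq by (simp add: ennreal_mult_cancel_left)
qed

lemma lborel_distr_orthogonal:
  fixes T :: "'a::euclidean_space \<Rightarrow> 'a"
  assumes T: "orthogonal_transformation T"
  shows "distr lborel borel T = lborel"
proof (rule measure_eqI)
  fix X assume "X \<in> sets (distr lborel borel T)"
  then have [measurable]: "X \<in> sets borel" by simp
  note [measurable] = orthogonal_transformation_borel_measurable[OF T]
  show "emeasure (distr lborel borel T) X = emeasure lborel X"
    using nn_integral_lborel_orthogonal[OF T, of "indicator X"]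
      nn_integral_distr[of T lborel borel "indicator X"] by simp
qed simp

text \<open>For each fixed \<open>s\<close> the shear is a translation of the first coordinate.\<close>
lemma lborel_distr_shear:
  fixes e :: "'a::euclidean_space"
  shows "distr (lborel \<Otimes>\<^sub>M lborel) (lborel \<Otimes>\<^sub>M lborel) (\<lambda>(w, s). (w - s *\<^sub>R e, s))
    = (lborel \<Otimes>\<^sub>M (lborel :: real measure))" (is "distr ?M ?M ?S = ?M")
proof (rule measure_eqI)
  fix X assume "X \<in> sets (distr ?M ?M ?S)"
  then have X[measurable]: "X \<in> sets ?M" by simp
  have [measurable]: "?S \<in> ?M \<rightarrow>\<^sub>M ?M" by simp
  have "emeasure (distr ?M ?M ?S) X = (\<integral>\<^sup>+z. indicator X z \<partial>distr ?M ?M ?S)"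
    using X by (intro nn_integral_indicator[symmetric]) simp
  also have "\<dots> = (\<integral>\<^sup>+z. indicator X (?S z) \<partial>?M)"
    by (rule nn_integral_distr) simp_all
  also have "\<dots> = (\<integral>\<^sup>+s. \<integral>\<^sup>+w. indicator X (w - s *\<^sub>R e, s) \<partial>lborel \<partial>lborel)"
    by (subst lborel_pair.nn_integral_snd[symmetric]) auto
  also have "\<dots> = (\<integral>\<^sup>+s. \<integral>\<^sup>+w. indicator X (w, s) \<partial>lborel \<partial>lborel)"
    using nn_integral_lborel_translate[of "\<lambda>w. indicator X (w, s)" "- s *\<^sub>R e" for s]
    by (simp cong: nn_integral_cong)
  also have "\<dots> = emeasure ?M X"
    using X by (subst lborel_pair.nn_integral_snd) (auto intro: nn_integral_indicator)
  finally show "emeasure (distr ?M ?M ?S) X = emeasure ?M X" .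
qed simp

section \<open>The tail kernel along a line\<close>

text \<open>This is the kernel \<open>Q\<close> as a function of the radius \<open>r\<close>. Its values lie in \<open>[0,\<infinity>]\<close>, so that
  finiteness can be read off afterwards from Fubini's theorem.\<close>
definition tail :: "(real \<Rightarrow> real) \<Rightarrow> real \<Rightarrow> ennreal" where
  "tail p r = (\<integral>\<^sup>+t. ennreal (p t / t) * indicator {r<..} t \<partial>lborel)"

text \<open>The component in direction \<open>e\<close> of the vector kernel \<open>p |w| w / |w|\<^sup>2\<close> that appears in the nonlocal
  gradient.\<close>
definition line_ker :: "(real \<Rightarrow> real) \<Rightarrow> 'a::euclidean_space \<Rightarrow> 'a \<Rightarrow> real" where
  "line_ker p e w = p (norm w) * (w \<bullet> e) / (norm w)\<^sup>2"

lemma norm_line_has_derivative: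
  fixes z e :: "'a::euclidean_space"
  assumes "z + s *\<^sub>R e \<noteq> 0"
  shows "((\<lambda>s. norm (z + s *\<^sub>R e)) has_real_derivative
    (z + s *\<^sub>R e) \<bullet> e / norm (z + s *\<^sub>R e)) (at s)"
proof -
  have "((\<lambda>s. norm (z + s *\<^sub>R e)) has_derivative
      (\<lambda>h. (h *\<^sub>R e) \<bullet> sgn (z + s *\<^sub>R e))) (at s)"
    by (rule has_derivative_compose[where f = "\<lambda>s. z + s *\<^sub>R e" and g = norm])
       (use has_derivative_norm[OF assms] in \<open>auto intro!: derivative_eq_intros\<close>)
  then show ?thesis
    unfolding has_field_derivative_def
    by (rule has_derivative_eq_rhs)
       (auto simp: fun_eq_iff sgn_div_norm inner_commute divide_inverse)
qed

text \<open>In the open half space \<open>z \<bullet> e > 0\<close> the radius \<open>|z + s e|\<close> is strictly increasing in \<open>s \<ge> 0\<close> with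
  nonvanishing derivative, so it may serve as the variable of integration.\<close>
lemma nn_integral_line_radius:
  fixes z e :: "'a::euclidean_space" and f :: "real \<Rightarrow> ennreal"
  assumes ze: "0 < z \<bullet> e" and e: "norm e = 1" and f[measurable]: "f \<in> borel_measurable borel"
  shows "(\<integral>\<^sup>+t. f t * indicator {norm z<..} t \<partial>lborel)
    = (\<integral>\<^sup>+s. f (norm (z + s *\<^sub>R e)) * ennreal ((z + s *\<^sub>R e) \<bullet> e / norm (z + s *\<^sub>R e))
         * indicator {0<..} s \<partial>lborel)"
proof -
  define g where "g s = norm (z + s *\<^sub>R e)" for s
  define g' where "g' s = (z + s *\<^sub>R e) \<bullet> e / norm (z + s *\<^sub>R e)" for s
  have pos: "0 < (z + s *\<^sub>R e) \<bullet> e" if "0 \<le> s" for s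
    using ze e that by (simp add: inner_left_distrib dot_square_norm add_pos_nonneg)
  then have nz: "z + s *\<^sub>R e \<noteq> 0" if "0 \<le> s" for s
    using that by (metis inner_zero_left less_irrefl)
  have deriv: "(g has_real_derivative g' s) (at s)" if "0 \<le> s" for s
    unfolding g_def g'_def by (rule norm_line_has_derivative) (rule nz[OF that])
  have cont: "continuous_on {0..b} g'" for b
    unfolding g'_def using nz by (auto intro!: continuous_intros)
  have [measurable]: "g \<in> borel_measurable borel" "g' \<in> borel_measurable borel"
    unfolding g_def g'_def by measurable
  have g'_nn: "0 \<le> g' s" if "0 \<le> s" for s
    using pos[OF that] by (simp add: g'_def)
  have mono: "g a \<le> g b" if "0 \<le> a" "a \<le> b" for a b
  proof (rule DERIV_nonneg_imp_nondecreasing[OF that(2)])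
    fix x assume "a \<le> x" "x \<le> b"
    with that have "0 \<le> x" by linarith
    then show "\<exists>y. (g has_real_derivative y) (at x) \<and> 0 \<le> y"
      using deriv g'_nn by blast
  qed
  have g_ge: "s - norm z \<le> g s" if "0 \<le> s" for s
    using norm_triangle_ineq2[of "s *\<^sub>R e" "- z"] that e by (simp add: g_def add.commute)
  have g0: "g 0 = norm z" by (simp add: g_def)
  have step: "(\<integral>\<^sup>+t. f t * indicator {norm z..g (real (Suc n))} t \<partial>lborel)
      = (\<integral>\<^sup>+s. f (g s) * g' s * indicator {0..real (Suc n)} s \<partial>lborel)" for n
    using nn_integral_substitution_aux[of f 0 "real (Suc n)" g g'] deriv cont g'_nn g0 by auto
  have lim1: "(\<lambda>n. \<integral>\<^sup>+t. f t * indicator {norm z..g (real (Suc n))} t \<partial>lborel)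
      \<longlonglongrightarrow> (\<integral>\<^sup>+t. f t * indicator {norm z..} t \<partial>lborel)"
  proof (rule nn_integral_LIMSEQ)
    show "incseq (\<lambda>n t. f t * indicator {norm z..g (real (Suc n))} t)"
    proof (intro incseq_SucI le_funI)
      fix n t
      have "g (real (Suc n)) \<le> g (real (Suc (Suc n)))" by (rule mono) auto
      then show "f t * indicator {norm z..g (real (Suc n))} t
          \<le> f t * indicator {norm z..g (real (Suc (Suc n)))} t"
        by (auto simp: indicator_def)
    qed
    show "(\<lambda>n. f t * indicator {norm z..g (real (Suc n))} t) \<longlonglongrightarrow> f t * indicator {norm z..} t" for t
    proof (rule tendsto_eventually, rule eventually_sequentiallyI)
      fix n assume "nat \<lceil>t + norm z\<rceil> \<le> n"
      then have "t + norm z \<le> real (Suc n)" by linarith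
      then have "t \<le> g (real (Suc n))" using g_ge[of "real (Suc n)"] by linarith
      then show "f t * indicator {norm z..g (real (Suc n))} t = f t * indicator {norm z..} t"
        by (auto simp: indicator_def)
    qed
  qed measurable
  have lim2: "(\<lambda>n. \<integral>\<^sup>+s. f (g s) * g' s * indicator {0..real (Suc n)} s \<partial>lborel)
      \<longlonglongrightarrow> (\<integral>\<^sup>+s. f (g s) * g' s * indicator {0..} s \<partial>lborel)"
  proof (rule nn_integral_LIMSEQ)
    show "incseq (\<lambda>n s. f (g s) * ennreal (g' s) * indicator {0..real (Suc n)} s)"
      by (auto simp: incseq_def le_fun_def indicator_def)
    show "(\<lambda>n. f (g s) * ennreal (g' s) * indicator {0..real (Suc n)} s)
        \<longlonglongrightarrow> f (g s) * ennreal (g' s) * indicator {0..} s" for s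
    proof (rule tendsto_eventually, rule eventually_sequentiallyI)
      fix n assume "nat \<lceil>s\<rceil> \<le> n"
      then have "s \<le> real (Suc n)" by linarith
      then show "f (g s) * ennreal (g' s) * indicator {0..real (Suc n)} s
          = f (g s) * ennreal (g' s) * indicator {0..} s"
        by (auto simp: indicator_def)
    qed
  qed measurable
  have "(\<integral>\<^sup>+t. f t * indicator {norm z<..} t \<partial>lborel)
      = (\<integral>\<^sup>+t. f t * indicator {norm z..} t \<partial>lborel)"
    using AE_lborel_singleton[of "norm z"]
    by (intro nn_integral_cong_AE) (auto elim!: eventually_mono simp: indicator_def)
  also have "\<dots> = (\<integral>\<^sup>+s. f (g s) * g' s * indicator {0..} s \<partial>lborel)"
    by (rule LIMSEQ_unique[OF lim1]) (use lim2 in \<open>simp only: step\<close>)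
  also have "\<dots> = (\<integral>\<^sup>+s. f (g s) * g' s * indicator {0<..} s \<partial>lborel)"
    using AE_lborel_singleton[of "0::real"]
    by (intro nn_integral_cong_AE) (auto elim!: eventually_mono simp: indicator_def)
  finally show ?thesis by (simp add: g_def g'_def)
qed

text \<open>This is the relation between the tail and \<open>line_ker\<close> in integrated form; it avoids any
  differentiability of the tail.\<close>
lemma tail_eq_line_integral:
  fixes z e :: "'a::euclidean_space"
  assumes "0 < z \<bullet> e" and e: "norm e = 1" and [measurable]: "p \<in> borel_measurable borel"
    and p: "\<And>t. 0 \<le> p t"
  shows "tail p (norm z) = (\<integral>\<^sup>+s. ennreal (line_ker p e (z + s *\<^sub>R e)) * indicator {0<..} s \<partial>lborel)"
proof -
  have "ennreal (p r / r) * ennreal (a / r) = ennreal (p r * a / r\<^sup>2)" if "0 \<le> r" for a r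
    using that p[of r] by (simp flip: ennreal_mult' add: power2_eq_square)
  then show ?thesis
    unfolding tail_def line_ker_def
    by (subst nn_integral_line_radius[OF assms(1,2)]) auto
qed

lemma tail_borel_measurable [measurable]:
  assumes [measurable]: "p \<in> borel_measurable borel"
  shows "tail p \<in> borel_measurable borel"
proof -
  have "(\<lambda>r. \<integral>\<^sup>+t. ennreal (p t / t) * (if r < t then 1 else 0) \<partial>lborel) \<in> borel_measurable borel"
    by measurable
  also have "(\<lambda>r. \<integral>\<^sup>+t. ennreal (p t / t) * (if r < t then 1 else 0) \<partial>lborel) = tail p"
    by (auto simp: tail_def fun_eq_iff indicator_def intro!: nn_integral_cong)
  finally show ?thesis .
qed

lemma line_ker_borel_measurable [measurable]:
  assumes [measurable]: "p \<in> borel_measurable borel"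
  shows "line_ker p e \<in> borel_measurable borel"
  unfolding line_ker_def by measurable

lemma abs_line_ker_le:
  assumes "norm e = 1" "\<And>t. 0 \<le> p t"
  shows "\<bar>line_ker p e w\<bar> \<le> p (norm w) / norm w"
proof (cases "w = 0")
  case False
  have "\<bar>w \<bullet> e\<bar> \<le> norm w" using Cauchy_Schwarz_ineq2[of w e] assms by simp
  then have "p (norm w) * \<bar>w \<bullet> e\<bar> / (norm w)\<^sup>2 \<le> p (norm w) * norm w / (norm w)\<^sup>2"
    using assms by (intro divide_right_mono mult_left_mono) auto
  then show ?thesis using assms False
    by (simp add: line_ker_def abs_mult power2_eq_square)
qed (simp add: line_ker_def)

section \<open>Integration by parts against the tail kernel\<close>

abbreviation tail_ker :: "(real \<Rightarrow> real) \<Rightarrow> 'a::euclidean_space \<Rightarrow> real" where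
  "tail_ker p z \<equiv> enn2real (tail p (norm z))"

text \<open>Both sides are iterated integrals of \<open>F (z, s) = K (z + s e) h z\<close> over \<open>z \<bullet> e > 0\<close> and \<open>s > 0\<close>, in the
  coordinates \<open>(z, s)\<close> and in the sheared coordinates \<open>w = z + s e\<close>. In the latter the domain becomes
  \<open>0 < s < w \<bullet> e\<close>, and \<open>m\<close> bounds what the inner integral contributes, so that the
  hypothesis on \<open>m\<close> yields the absolute integrability of \<open>F\<close>.\<close>
lemma halfspace_integral:
  fixes h :: "'a::euclidean_space \<Rightarrow> 'b::euclidean_space"
  assumes [measurable]: "p \<in> borel_measurable borel" and p: "\<And>t. 0 \<le> p t"
    and e: "norm e = 1" and [measurable]: "h \<in> borel_measurable borel"
    and bound: "\<And>w. 0 < w \<bullet> e \<Longrightarrow>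
      (\<integral>\<^sup>+s. ennreal (norm (h (w - s *\<^sub>R e))) * indicator {0<..<w \<bullet> e} s \<partial>lborel) \<le> ennreal (m (norm w))"
    and m: "\<And>r. 0 \<le> m r"
    and fin: "(\<integral>\<^sup>+w. ennreal (p (norm w) / norm w * m (norm w)) \<partial>(lborel :: 'a measure)) < \<infinity>"
  defines "A \<equiv> \<lambda>z. indicator {z. 0 < z \<bullet> e} z *\<^sub>R (tail_ker p z *\<^sub>R h z)"
    and "J \<equiv> \<lambda>w. indicator {w. 0 < w \<bullet> e} w *\<^sub>R (line_ker p e w *\<^sub>R
      (\<integral>s. indicator {0<..<w \<bullet> e} s *\<^sub>R h (w - s *\<^sub>R e) \<partial>lborel))"
  shows "integrable lborel A" "integrable lborel J" "(\<integral>z. A z \<partial>lborel) = (\<integral>w. J w \<partial>lborel)"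
proof -
  let ?M = "lborel \<Otimes>\<^sub>M (lborel :: real measure)" and ?S = "\<lambda>(w, s). (w - s *\<^sub>R e, s)"
  define k where "k z s = indicator {z. 0 < z \<bullet> e} z * indicator {0<..} s * line_ker p e (z + s *\<^sub>R e)"
    for z :: 'a and s :: real
  define F where "F = (\<lambda>(z, s). k z s *\<^sub>R h z)"
  have [measurable]: "(\<lambda>(z, s). k z s) \<in> borel_measurable ?M"
    unfolding k_def by measurable
  have F[measurable]: "F \<in> borel_measurable ?M"
    unfolding F_def by measurable
  have S[measurable]: "?S \<in> ?M \<rightarrow>\<^sub>M ?M" by simp
  have K_nn: "0 \<le> line_ker p e w" if "0 < w \<bullet> e" for w
    using that p by (simp add: line_ker_def)
  have FS: "F (w - s *\<^sub>R e, s)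
      = (indicator {w. 0 < w \<bullet> e} w * line_ker p e w) *\<^sub>R (indicator {0<..<w \<bullet> e} s *\<^sub>R h (w - s *\<^sub>R e))" for w s
    using e by (auto simp: F_def k_def indicator_def inner_diff_left dot_square_norm)
  have "(\<integral>\<^sup>+x. norm (F x) \<partial>?M) = (\<integral>\<^sup>+x. norm (F x) \<partial>distr ?M ?M ?S)"
    by (simp only: lborel_distr_shear)
  also have "\<dots> = (\<integral>\<^sup>+x. norm (F (?S x)) \<partial>?M)"
    by (rule nn_integral_distr) simp_all
  also have "\<dots> = (\<integral>\<^sup>+w. \<integral>\<^sup>+s. norm (F (w - s *\<^sub>R e, s)) \<partial>lborel \<partial>lborel)"
    by (subst lborel.nn_integral_fst[symmetric]) auto
  also have "\<dots> \<le> (\<integral>\<^sup>+w. ennreal (p (norm w) / norm w * m (norm w)) \<partial>(lborel :: 'a measure))"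
  proof (intro nn_integral_mono)
    fix w :: 'a
    let ?c = "indicator {w. 0 < w \<bullet> e} w * line_ker p e w"
    have "(\<integral>\<^sup>+s. norm (F (w - s *\<^sub>R e, s)) \<partial>lborel)
        = (\<integral>\<^sup>+s. ennreal \<bar>?c\<bar> * (ennreal (norm (h (w - s *\<^sub>R e))) * indicator {0<..<w \<bullet> e} s) \<partial>lborel)"
      unfolding FS by (intro nn_integral_cong) (auto simp: indicator_def ennreal_mult)
    also have "\<dots> = ennreal \<bar>?c\<bar> * (\<integral>\<^sup>+s. ennreal (norm (h (w - s *\<^sub>R e))) * indicator {0<..<w \<bullet> e} s \<partial>lborel)"
      by (rule nn_integral_cmult) measurable
    also have "\<dots> \<le> ennreal (p (norm w) / norm w) * ennreal (m (norm w))"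
    proof (cases "0 < w \<bullet> e")
      case True
      then show ?thesis
        using abs_line_ker_le[of e p, OF e p] bound[OF True] by (intro mult_mono ennreal_leI) auto
    qed simp
    finally show "(\<integral>\<^sup>+s. norm (F (w - s *\<^sub>R e, s)) \<partial>lborel) \<le> ennreal (p (norm w) / norm w * m (norm w))"
      using p m by (simp flip: ennreal_mult')
  qed
  finally have fin': "(\<integral>\<^sup>+x. norm (F x) \<partial>?M) < \<infinity>"
    using fin by (rule le_less_trans)
  then have int: "integrable ?M F"
    by (intro integrableI_bounded F)
  have "integrable (distr ?M ?M ?S) F"
    using int by (simp only: lborel_distr_shear)
  then have intS: "integrable ?M (\<lambda>x. F (?S x))"
    by (rule integrable_distr[OF S])
  have "(\<integral>x. F x \<partial>?M) = (\<integral>x. F x \<partial>distr ?M ?M ?S)"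
    by (simp only: lborel_distr_shear)
  also have "\<dots> = (\<integral>x. F (?S x) \<partial>?M)"
    by (rule integral_distr) simp_all
  finally have eqS: "(\<integral>x. F x \<partial>?M) = (\<integral>x. F (?S x) \<partial>?M)" .
  have J: "J w = (\<integral>s. F (?S (w, s)) \<partial>lborel)" for w
    unfolding J_def prod.case FS integral_scaleR_right by simp
  show intJ: "integrable lborel J"
    unfolding ext[of J, OF J] by (rule lborel_pair.integrable_fst'[OF intS])
  have eqJ: "(\<integral>w. J w \<partial>lborel) = (\<integral>x. F x \<partial>?M)"
    unfolding eqS J by (rule lborel_pair.integral_fst'[OF intS])
  have "AE z in lborel. integrable lborel (\<lambda>s. F (z, s))"
    by (rule lborel_pair.AE_integrable_fst'[OF int])
  \<comment> \<open>The tail may be infinite, and its real value is then the default \<open>0\<close>. Integrability of \<open>F (z, \<cdot>)\<close> excludes this for almost every \<open>z\<close> with \<open>h z \<noteq> 0\<close>.\<close>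
  then have A: "AE z in lborel. (\<integral>s. F (z, s) \<partial>lborel) = A z"
  proof eventually_elim
    case (elim z)
    show ?case
    proof (cases "0 < z \<bullet> e \<and> h z \<noteq> 0")
      case True
      have pos: "0 \<le> line_ker p e (z + s *\<^sub>R e)" if "0 < s" for s
        using that True e by (intro K_nn) (simp add: inner_add_left dot_square_norm add_pos_pos)
      have kzm: "k z \<in> borel_measurable lborel" unfolding k_def by measurable
      have "(\<integral>s. k z s \<partial>lborel) = enn2real (\<integral>\<^sup>+s. ennreal (k z s) \<partial>lborel)"
        by (rule integral_eq_nn_integral) (auto simp: k_def indicator_def pos)
      also have "(\<integral>\<^sup>+s. ennreal (k z s) \<partial>lborel)
          = (\<integral>\<^sup>+s. ennreal (line_ker p e (z + s *\<^sub>R e)) * indicator {0<..} s \<partial>lborel)"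
        using True by (intro nn_integral_cong) (auto simp: k_def indicator_def)
      also have "\<dots> = tail p (norm z)"
        using True by (subst tail_eq_line_integral[of z e p]) (auto simp: e p)
      finally have kz: "(\<integral>s. k z s \<partial>lborel) = tail_ker p z" .
      have "integrable lborel (\<lambda>s. k z s *\<^sub>R h z)"
        using elim by (simp add: F_def)
      then have "integrable lborel (\<lambda>s. inverse (norm (h z)) * norm (k z s *\<^sub>R h z))"
        by (intro integrable_mult_right integrable_norm)
      then have "integrable lborel (\<lambda>s. \<bar>k z s\<bar>)"
        using True by (simp add: field_simps)
      then have "integrable lborel (k z)"
        using kzm by (rule integrable_abs_cancel)
      then have "(\<integral>s. k z s *\<^sub>R h z \<partial>lborel) = (\<integral>s. k z s \<partial>lborel) *\<^sub>R h z"
        by (intro integral_scaleR_left)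
      then show ?thesis using True kz by (simp add: F_def A_def)
    qed (auto simp: F_def k_def A_def)
  qed
  have [measurable]: "A \<in> borel_measurable borel" unfolding A_def by measurable
  have intF: "integrable lborel (\<lambda>z. \<integral>s. F (z, s) \<partial>lborel)"
    by (rule lborel_pair.integrable_fst'[OF int])
  then show "integrable lborel A"
    by (rule integrable_cong_AE_imp) (use A in auto)
  have "(\<integral>z. A z \<partial>lborel) = (\<integral>z. \<integral>s. F (z, s) \<partial>lborel \<partial>lborel)"
    using A borel_measurable_integrable[OF intF] by (intro integral_cong_AE) auto
  also have "\<dots> = (\<integral>x. F x \<partial>?M)"
    by (rule lborel_pair.integral_fst'[OF int])
  finally show "(\<integral>z. A z \<partial>lborel) = (\<integral>w. J w \<partial>lborel)"
    using eqJ by simp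
qed

lemma integral_along_line:
  fixes h v :: "'a::euclidean_space \<Rightarrow> 'b::euclidean_space"
  assumes h: "continuous_on UNIV h"
    and v: "\<And>a s. ((\<lambda>s. v (a + s *\<^sub>R e)) has_vector_derivative h (a + s *\<^sub>R e)) (at s)"
    and l: "0 \<le> l"
  shows "(\<integral>s. indicator {0<..<l} s *\<^sub>R h (w - s *\<^sub>R e) \<partial>lborel) = v w - v (w - l *\<^sub>R e)"
proof -
  have d: "((\<lambda>s. - v (w - s *\<^sub>R e)) has_vector_derivative h (w - s *\<^sub>R e)) (at s within X)" for s X
  proof -
    have "((\<lambda>s. v (w + s *\<^sub>R e)) \<circ> uminus has_vector_derivative (-1) *\<^sub>R h (w + (- s) *\<^sub>R e)) (at s)"
      using v[of w "- s"] by (intro vector_diff_chain_at) (auto intro!: derivative_eq_intros)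
    then have "((\<lambda>s. - v (w - s *\<^sub>R e)) has_vector_derivative h (w - s *\<^sub>R e)) (at s)"
      using has_vector_derivative_minus by (fastforce simp: o_def)
    then show ?thesis by (rule has_vector_derivative_at_within)
  qed
  have "(\<integral>s. indicator {0<..<l} s *\<^sub>R h (w - s *\<^sub>R e) \<partial>lborel)
      = (\<integral>s. indicator {0..l} s *\<^sub>R h (w - s *\<^sub>R e) \<partial>lborel)"
  proof (rule integral_cong_AE)
    show "AE s in lborel. indicator {0<..<l} s *\<^sub>R h (w - s *\<^sub>R e) = indicator {0..l} s *\<^sub>R h (w - s *\<^sub>R e)"
      using AE_lborel_singleton[of 0] AE_lborel_singleton[of l]
      by eventually_elim (auto simp: indicator_def)
    have [measurable]: "h \<in> borel_measurable borel" by (rule borel_measurable_continuous_onI[OF h])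
    show "(\<lambda>s. indicator {0<..<l} s *\<^sub>R h (w - s *\<^sub>R e)) \<in> borel_measurable lborel"
      "(\<lambda>s. indicator {0..l} s *\<^sub>R h (w - s *\<^sub>R e)) \<in> borel_measurable lborel"
      by measurable
  qed
  also have "\<dots> = - v (w - l *\<^sub>R e) - - v (w - 0 *\<^sub>R e)"
    by (rule integral_FTC_Icc[OF l d])
       (intro continuous_on_compose2[OF h] continuous_intros, auto)
  finally show ?thesis by simp
qed

text \<open>The two open half spaces bounded by the hyperplane orthogonal to \<open>e\<close> cover everything up to a null
  set, and the lower one is the upper one for \<open>- e\<close>.\<close>
lemma both_halfspaces_integral:
  fixes h :: "'a::euclidean_space \<Rightarrow> 'b::euclidean_space"
  assumes pm[measurable]: "p \<in> borel_measurable borel" and p: "\<And>t. 0 \<le> p t"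
    and e: "norm e = 1" and hm[measurable]: "h \<in> borel_measurable borel"
    and bound: "\<And>c w. norm c = 1 \<Longrightarrow> 0 < w \<bullet> c \<Longrightarrow>
      (\<integral>\<^sup>+s. ennreal (norm (h (w - s *\<^sub>R c))) * indicator {0<..<w \<bullet> c} s \<partial>lborel) \<le> ennreal (m (norm w))"
    and fin: "(\<integral>\<^sup>+w. ennreal (p (norm w) / norm w * m (norm w)) \<partial>(lborel :: 'a measure)) < \<infinity>"
    and m: "\<And>r. 0 \<le> m r"
  defines "J \<equiv> \<lambda>c w. indicator {w. 0 < w \<bullet> c} w *\<^sub>R (line_ker p c w *\<^sub>R
      (\<integral>s. indicator {0<..<w \<bullet> c} s *\<^sub>R h (w - s *\<^sub>R c) \<partial>lborel))"
  shows "integrable lborel (\<lambda>z. tail_ker p z *\<^sub>R h z)"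
    and "integrable lborel (\<lambda>w. J e w + J (- e) w)"
    and "(\<integral>z. tail_ker p z *\<^sub>R h z \<partial>lborel) = (\<integral>w. J e w + J (- e) w \<partial>lborel)"
proof -
  let ?A = "\<lambda>c z. indicator {z. 0 < z \<bullet> c} z *\<^sub>R (tail_ker p z *\<^sub>R h z)"
  have half: "integrable lborel (?A c)" "integrable lborel (J c)"
    "(\<integral>z. ?A c z \<partial>lborel) = (\<integral>w. J c w \<partial>lborel)" if c: "norm c = 1" for c
    using halfspace_integral[of p c h m, OF pm p c hm bound[OF c] m fin] unfolding J_def
    by simp_all
  have ne: "norm (- e) = 1" using e by simp
  note plus = half[OF e] and minus = half[OF ne]
  have intA: "integrable lborel (\<lambda>z. ?A e z + ?A (- e) z)"
    by (intro Bochner_Integration.integrable_add plus(1) minus(1))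
  show "integrable lborel (\<lambda>w. J e w + J (- e) w)"
    by (intro Bochner_Integration.integrable_add plus(2) minus(2))
  have eqAJ: "(\<integral>z. ?A e z + ?A (- e) z \<partial>lborel) = (\<integral>w. J e w + J (- e) w \<partial>lborel)"
    using Bochner_Integration.integral_add[OF plus(1) minus(1)]
      Bochner_Integration.integral_add[OF plus(2) minus(2)] plus(3) minus(3) by simp
  have "{z :: 'a. e \<bullet> z = 0} \<in> null_sets lborel"
  proof -
    have "negligible {z :: 'a. e \<bullet> z = 0}" using e by (intro negligible_hyperplane) auto
    then show ?thesis
      by (subst (asm) negligible_iff_null_sets) (simp add: null_sets_completion_iff closed_hyperplane borel_closed)
  qed
  then have "AE z in lborel. e \<bullet> z \<noteq> 0" by (auto dest: AE_not_in)
  then have Aeq: "AE z in lborel. ?A e z + ?A (- e) z = tail_ker p z *\<^sub>R h z"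
    by eventually_elim (auto simp: indicator_def inner_commute)
  show "integrable lborel (\<lambda>z. tail_ker p z *\<^sub>R h z)"
    by (rule integrable_cong_AE_imp[OF intA]) (use Aeq in auto)
  show "(\<integral>z. tail_ker p z *\<^sub>R h z \<partial>lborel) = (\<integral>w. J e w + J (- e) w \<partial>lborel)"
    using Aeq eqAJ by (subst integral_cong_AE[where g = "\<lambda>z. ?A e z + ?A (- e) z"]) auto
qed

text \<open>The line integrals of \<open>h\<close> evaluate to \<open>v w - v (perp w)\<close>, where \<open>perp w\<close> is the orthogonal projection of \<open>w\<close>
  on the hyperplane. Replacing \<open>v (perp w)\<close> by \<open>v 0\<close> changes the integrand by the function \<open>G\<close>
  below, which is odd under the reflection \<open>R\<close> in that hyperplane.\<close>
lemma kernel_integral_by_parts: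
  fixes h v :: "'a::euclidean_space \<Rightarrow> 'b::euclidean_space"
  assumes pm[measurable]: "p \<in> borel_measurable borel" and p: "\<And>t. 0 \<le> p t"
    and e: "norm e = 1" and h: "continuous_on UNIV h"
    and v: "\<And>a s. ((\<lambda>s. v (a + s *\<^sub>R e)) has_vector_derivative h (a + s *\<^sub>R e)) (at s)"
    and bound: "\<And>c w. norm c = 1 \<Longrightarrow> 0 < w \<bullet> c \<Longrightarrow>
      (\<integral>\<^sup>+s. ennreal (norm (h (w - s *\<^sub>R c))) * indicator {0<..<w \<bullet> c} s \<partial>lborel) \<le> ennreal (m (norm w))"
    and vbound: "\<And>w. norm (v w - v 0) \<le> m (norm w)" and vm[measurable]: "v \<in> borel_measurable borel"
    and fin: "(\<integral>\<^sup>+w. ennreal (p (norm w) / norm w * m (norm w)) \<partial>(lborel :: 'a measure)) < \<infinity>"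
    and m: "\<And>r. 0 \<le> m r"
  shows "integrable lborel (\<lambda>w. line_ker p e w *\<^sub>R (v w - v 0))"
    and "(\<integral>z. tail_ker p z *\<^sub>R h z \<partial>lborel) = (\<integral>w. line_ker p e w *\<^sub>R (v w - v 0) \<partial>lborel)"
proof -
  let ?K = "line_ker p e"
  define perp where "perp w = w - (w \<bullet> e) *\<^sub>R e" for w
  have hm[measurable]: "h \<in> borel_measurable borel" by (rule borel_measurable_continuous_onI[OF h])
  have [measurable]: "perp \<in> borel_measurable borel" unfolding perp_def by measurable
  have vneg: "((\<lambda>s. v (a + s *\<^sub>R (- e))) has_vector_derivative (- h (a + s *\<^sub>R (- e)))) (at s)" for a s
  proof -
    have "((\<lambda>s. v (a + s *\<^sub>R e)) \<circ> uminus has_vector_derivative (-1) *\<^sub>R h (a + (- s) *\<^sub>R e)) (at s)"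
      using v[of a "- s"] by (intro vector_diff_chain_at) (auto intro!: derivative_eq_intros)
    then show ?thesis by (simp add: o_def)
  qed
  have Kneg: "line_ker p (- e) w = - ?K w" for w by (simp add: line_ker_def)
  let ?J = "\<lambda>c w. indicator {w. 0 < w \<bullet> c} w *\<^sub>R (line_ker p c w *\<^sub>R
      (\<integral>s. indicator {0<..<w \<bullet> c} s *\<^sub>R h (w - s *\<^sub>R c) \<partial>lborel))"
  have Jeq: "?J e w + ?J (- e) w = ?K w *\<^sub>R (v w - v (perp w))" for w
  proof -
    consider "0 < w \<bullet> e" | "w \<bullet> e < 0" | "w \<bullet> e = 0" by linarith
    then show ?thesis
    proof cases
      case 1
      then show ?thesis
        using integral_along_line[OF h v, of "w \<bullet> e" w] by (simp add: perp_def)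
    next
      case 2
      have "(\<integral>s. indicator {0<..<- (w \<bullet> e)} s *\<^sub>R - h (w - s *\<^sub>R (- e)) \<partial>lborel) = v w - v (w - (- (w \<bullet> e)) *\<^sub>R (- e))"
        using 2 by (intro integral_along_line[of "\<lambda>x. - h x" v "- e"] vneg continuous_intros h) auto
      then have "(\<integral>s. indicator {0<..<- (w \<bullet> e)} s *\<^sub>R h (w - s *\<^sub>R (- e)) \<partial>lborel) = v (perp w) - v w"
        by (simp add: perp_def algebra_simps)
      then show ?thesis using 2 by (simp add: Kneg flip: scaleR_minus_right)
    next
      case 3
      then show ?thesis by (simp add: line_ker_def)
    qed
  qed
  have intJ': "integrable lborel (\<lambda>w. ?K w *\<^sub>R (v w - v (perp w)))"
    by (rule both_halfspaces_integral(2)[of p e h m, unfolded Jeq])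
       (assumption | rule pm p e hm fin m | erule (1) bound)+
  have QJ: "(\<integral>z. tail_ker p z *\<^sub>R h z \<partial>lborel) = (\<integral>w. ?K w *\<^sub>R (v w - v (perp w)) \<partial>lborel)"
    by (rule both_halfspaces_integral(3)[of p e h m, unfolded Jeq])
       (assumption | rule pm p e hm fin m | erule (1) bound)+
  show intv: "integrable lborel (\<lambda>w. ?K w *\<^sub>R (v w - v 0))"
  proof (rule integrableI_bounded)
    have "(\<integral>\<^sup>+w. ennreal (norm (?K w *\<^sub>R (v w - v 0))) \<partial>lborel)
        \<le> (\<integral>\<^sup>+w. ennreal (p (norm w) / norm w * m (norm w)) \<partial>(lborel :: 'a measure))"
      using abs_line_ker_le[of e p, OF e p] vbound p m
      by (intro nn_integral_mono ennreal_leI) (unfold norm_scaleR, intro mult_mono, auto)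
    then show "(\<integral>\<^sup>+w. ennreal (norm (?K w *\<^sub>R (v w - v 0))) \<partial>lborel) < \<infinity>"
      using fin by (rule le_less_trans)
  qed measurable
  define G where "G w = ?K w *\<^sub>R (v (perp w) - v 0)" for w
  have Gdiff: "G w = ?K w *\<^sub>R (v w - v 0) - ?K w *\<^sub>R (v w - v (perp w))" for w
    by (simp add: G_def algebra_simps)
  have intG: "integrable lborel G"
    unfolding Gdiff by (intro Bochner_Integration.integrable_diff intv intJ')
  define R where "R w = w - (2 * (w \<bullet> e)) *\<^sub>R e" for w
  have R: "orthogonal_transformation R"
    unfolding orthogonal_transformation_def R_def
  proof (intro conjI allI linearI)
    fix x y :: 'a
    show "(x - (2 * (x \<bullet> e)) *\<^sub>R e) \<bullet> (y - (2 * (y \<bullet> e)) *\<^sub>R e) = x \<bullet> y"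
      using e by (simp add: inner_diff_left inner_diff_right dot_square_norm inner_commute)
  qed (auto simp: algebra_simps inner_add_left)
  have Re: "R w \<bullet> e = - (w \<bullet> e)" for w
    using e by (simp add: R_def inner_diff_left dot_square_norm)
  have "G (R w) = - G w" for w
  proof -
    have "perp (R w) = perp w" unfolding perp_def Re by (simp add: R_def algebra_simps flip: scaleR_add_left)
    moreover have "?K (R w) = - ?K w"
      by (simp add: line_ker_def Re orthogonal_transformation_norm[OF R])
    ultimately show ?thesis by (simp add: G_def)
  qed
  then have "(\<integral>w. G w \<partial>lborel) = - (\<integral>w. G w \<partial>lborel)"
    using integral_distr[of R lborel borel G] orthogonal_transformation_borel_measurable[OF R]
      borel_measurable_integrable[OF intG]
    by (simp add: lborel_distr_orthogonal[OF R])
  then have "(\<integral>w. G w \<partial>lborel) = 0"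
    by (simp add: eq_neg_iff_add_eq_0 flip: scaleR_2)
  then have "(\<integral>w. ?K w *\<^sub>R (v w - v 0) \<partial>lborel) = (\<integral>w. ?K w *\<^sub>R (v w - v (perp w)) \<partial>lborel)"
    unfolding Gdiff using Bochner_Integration.integral_diff[OF intv intJ'] by simp
  then show "(\<integral>z. tail_ker p z *\<^sub>R h z \<partial>lborel) = (\<integral>w. ?K w *\<^sub>R (v w - v 0) \<partial>lborel)"
    using QJ by simp
qed

section \<open>Radial Lebesgue measurable functions\<close>

lemma AE_lborel_iff_negligible:
  "(AE x in (lborel :: 'a::euclidean_space measure). P x) \<longleftrightarrow> negligible {x. \<not> P x}"
proof -
  have "(AE x in lborel. P x) \<longleftrightarrow> (AE x in lebesgue. P x)"
    by (simp add: AE_completion_iff)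
  then show ?thesis
    by (simp add: completion.AE_iff_null_sets negligible_iff_null_sets)
qed

text \<open>A null set is met in a null set by almost every line of a given direction: for each \<open>s\<close> its
  translate by \<open>s e\<close> is null, and Fubini's theorem exchanges the quantifiers.\<close>
lemma AE_lborel_line:
  fixes e :: "'a::euclidean_space"
  assumes "AE x in lborel. P x"
  shows "AE x in lborel. AE s in (lborel :: real measure). P (x + s *\<^sub>R e)"
proof -
  obtain N where N: "N \<in> null_sets lborel" "{x. \<not> P x} \<subseteq> N"
    using assms by (auto elim!: AE_E simp: null_sets_def)
  then have [measurable]: "N \<in> sets borel" by auto
  have "AE x in lborel. x + s *\<^sub>R e \<notin> N" for s
  proof -
    have "AE x in distr lborel borel ((+) (s *\<^sub>R e)). x \<notin> N"
      unfolding lborel_distr_plus using N(1) by (rule AE_not_in)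
    then have "AE x in lborel. s *\<^sub>R e + x \<notin> N"
      by (rule AE_distrD[rotated]) simp
    then show ?thesis by (simp add: add.commute)
  qed
  then have "AE s in (lborel :: real measure). AE x in lborel. x + s *\<^sub>R e \<notin> N"
    by simp
  then have "AE x in lborel. AE s in (lborel :: real measure). x + s *\<^sub>R e \<notin> N"
  proof (subst lborel_pair.AE_commute)
    have "Measurable.pred (lborel \<Otimes>\<^sub>M (lborel :: real measure)) (\<lambda>z. fst z + snd z *\<^sub>R e \<notin> N)"
      by measurable
    then show "{z \<in> space (lborel \<Otimes>\<^sub>M (lborel :: real measure)). fst z + snd z *\<^sub>R e \<notin> N}
        \<in> sets (lborel \<Otimes>\<^sub>M lborel)"
      by (simp only: pred_def)
  qed
  then show ?thesis
    by (rule AE_mp) (use N(2) in \<open>auto intro!: AE_I2 elim!: eventually_mono\<close>)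
qed

text \<open>Polar coordinates are not needed here. For the profile \<open>p\<close> that is the indicator of a null set the tail vanishes, and
  \<open>kernel_integral_by_parts\<close> with \<open>v w = w \<bullet> e\<close> says that the integral of \<open>p |w| (w \<bullet> e / |w|)\<^sup>2\<close> vanishes
  as well.\<close>
lemma radial_null:
  assumes N: "N \<in> null_sets (lborel :: real measure)"
  shows "AE x in (lborel :: 'a::euclidean_space measure). norm x \<in> N \<longrightarrow> x = 0"
proof -
  obtain e :: 'a where e: "e \<in> Basis" using SOME_Basis by blast
  then have ne: "norm e = 1" by simp
  have [measurable]: "N \<in> sets borel" using N by auto
  have step: "AE x in (lborel :: 'a measure). norm x \<in> N \<and> norm x \<le> real R \<longrightarrow> x \<bullet> e = 0" for R
  proof -
    \<comment> \<open>The truncation at radius \<open>R\<close> makes the profile integrable.\<close>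
    define p :: "real \<Rightarrow> real" where "p = indicator (N \<inter> {0..real R})"
    have [measurable]: "p \<in> borel_measurable borel" unfolding p_def by measurable
    have p: "0 \<le> p t" for t by (simp add: p_def)
    have "tail p r = 0" for r
    proof -
      have "AE t in lborel. t \<notin> N" using N by (rule AE_not_in)
      then have "tail p r = (\<integral>\<^sup>+t. 0 \<partial>(lborel :: real measure))"
        unfolding tail_def by (intro nn_integral_cong_AE) (auto elim!: eventually_mono simp: p_def)
      then show ?thesis by simp
    qed
    note Q0 = this
    have bound: "(\<integral>\<^sup>+s. ennreal (norm (1::real)) * indicator {0<..<w \<bullet> c} s \<partial>lborel) \<le> ennreal (norm w)"
      if "norm c = 1" "0 < w \<bullet> c" for c w :: 'a
      using that norm_cauchy_schwarz[of w c] by (simp add: nn_integral_cmult_indicator ennreal_leI)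
    have fin: "(\<integral>\<^sup>+w. ennreal (p (norm w) / norm w * norm w) \<partial>(lborel :: 'a measure)) < \<infinity>"
    proof -
      have "(\<integral>\<^sup>+w. ennreal (p (norm w) / norm w * norm w) \<partial>(lborel :: 'a measure))
          \<le> (\<integral>\<^sup>+w. indicator (cball (0::'a) (real R)) w \<partial>lborel)"
        by (intro nn_integral_mono) (auto simp: p_def indicator_def)
      also have "\<dots> < \<infinity>" using emeasure_bounded_finite[of "cball (0::'a) (real R)"] by simp
      finally show ?thesis .
    qed
    have deriv: "((\<lambda>s. (a + s *\<^sub>R e) \<bullet> e) has_vector_derivative 1) (at s)" for a :: 'a and s
      using ne by (auto intro!: derivative_eq_intros simp: dot_square_norm inner_add_left
          simp flip: has_real_derivative_iff_has_vector_derivative)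
    note by_parts = kernel_integral_by_parts[of p e "\<lambda>_. 1::real" "\<lambda>w. w \<bullet> e" "\<lambda>r. \<bar>r\<bar>"]
    have 1: "integrable lborel (\<lambda>w. line_ker p e w *\<^sub>R (w \<bullet> e - 0 \<bullet> e))"
      and 2: "(\<integral>w. line_ker p e w *\<^sub>R (w \<bullet> e - 0 \<bullet> e) \<partial>lborel) = 0"
      using by_parts bound fin deriv p ne Cauchy_Schwarz_ineq2[of _ e] by (simp_all add: Q0)
    have sq: "line_ker p e w *\<^sub>R (w \<bullet> e - 0 \<bullet> e) = p (norm w) * ((w \<bullet> e) / norm w)\<^sup>2" for w
      by (simp add: line_ker_def power2_eq_square)
    have "AE w in lborel. p (norm w) * ((w \<bullet> e) / norm w)\<^sup>2 = 0"
      using integral_nonneg_eq_0_iff_AE[of lborel "\<lambda>w. p (norm w) * ((w \<bullet> e) / norm w)\<^sup>2"] 1 2 p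
      unfolding sq by simp
    then show ?thesis
      by eventually_elim (auto simp: p_def)
  qed
  have "AE x in (lborel :: 'a measure). \<forall>R. norm x \<in> N \<and> norm x \<le> real R \<longrightarrow> x \<bullet> e = 0"
    unfolding AE_all_countable using step by blast
  moreover have "AE x in (lborel :: 'a measure). x \<bullet> e \<noteq> 0"
  proof -
    have "e \<noteq> 0" using ne by auto
    then show ?thesis
      unfolding AE_lborel_iff_negligible using negligible_hyperplane[of e 0] by (simp add: inner_commute)
  qed
  ultimately show ?thesis
    by eventually_elim (use real_arch_simple in blast)
qed

text \<open>On almost every line \<open>y + s e\<close> the function agrees almost everywhere with a Borel function. Choosing such a line very
  close to the origin and inverting \<open>t = |y + s e|\<close> recovers the profile \<open>g\<close> on \<open>(|y|,\<infinity>)\<close> from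
  this Borel function; a sequence of lines approaching the origin exhausts \<open>(0,\<infinity>)\<close>. The substitution is
  smooth, hence it maps null sets to null sets.\<close>
lemma radial_profile:
  fixes f :: "'a::euclidean_space \<Rightarrow> real"
  assumes f: "f \<in> borel_measurable lebesgue" and fg: "\<And>x. f x = g (norm x)" and g: "\<And>t. 0 \<le> g t"
  obtains p where "p \<in> borel_measurable borel" "\<And>t. 0 \<le> p t"
    "AE t in lborel. 0 < t \<longrightarrow> p t = g t" "AE x in lborel. f x = p (norm x)"
proof -
  obtain e :: 'a where "e \<in> Basis" using SOME_Basis by blast
  then have e: "norm e = 1" by simp
  obtain f0 where f0[measurable]: "f0 \<in> borel_measurable lborel" and ff0: "AE x in lborel. f x = f0 x"
    using completion_ex_borel_measurable_real[OF f] by auto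
  have line: "AE x in lborel. AE s in (lborel :: real measure). f (x + s *\<^sub>R e) = f0 (x + s *\<^sub>R e)"
    by (rule AE_lborel_line[OF ff0])
  have "\<exists>x. 0 < x \<bullet> e \<and> norm x < 1 / real (Suc k) \<and>
      (AE s in (lborel :: real measure). f (x + s *\<^sub>R e) = f0 (x + s *\<^sub>R e))" for k
  proof -
    let ?U = "{x. 0 < x \<bullet> e} \<inter> ball 0 (1 / real (Suc k))"
    have "open ?U" by (intro open_Int open_ball open_Collect_less continuous_intros)
    moreover have "(1 / (2 * real (Suc k))) *\<^sub>R e \<in> ?U"
      using e by (auto simp: dot_square_norm field_simps)
    ultimately have "\<not> negligible ?U" using open_not_negligible by blast
    then have "\<not> ?U \<subseteq> {x. \<not> (AE s in (lborel :: real measure). f (x + s *\<^sub>R e) = f0 (x + s *\<^sub>R e))}"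
      using line unfolding AE_lborel_iff_negligible[where 'a = 'a] using negligible_subset by blast
    then show ?thesis by auto
  qed
  then obtain y where y: "\<And>k. 0 < y k \<bullet> e" "\<And>k. norm (y k) < 1 / real (Suc k)"
    "\<And>k. AE s in (lborel :: real measure). f (y k + s *\<^sub>R e) = f0 (y k + s *\<^sub>R e)"
    by metis
  \<comment> \<open>\<open>\<sigma> k\<close> is the solution \<open>s > 0\<close> of \<open>|y k + s e| = t\<close>.\<close>
  define \<sigma> where "\<sigma> k t = sqrt (t\<^sup>2 - (norm (y k))\<^sup>2 + (y k \<bullet> e)\<^sup>2) - y k \<bullet> e" for k t
  define r where "r k t = (if norm (y k) < t then f0 (y k + \<sigma> k t *\<^sub>R e) else 0)" for k t
  have [measurable]: "r k \<in> borel_measurable borel" for k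
    unfolding r_def \<sigma>_def by measurable
  have rk: "AE t in lborel. norm (y k) < t \<longrightarrow> r k t = g t" for k
  proof -
    let ?B = "{s. \<not> (f (y k + s *\<^sub>R e) = f0 (y k + s *\<^sub>R e))} \<inter> {0<..}"
    let ?G = "\<lambda>s. norm (y k + s *\<^sub>R e)"
    have "negligible ?B" using y(3)[of k] unfolding AE_lborel_iff_negligible by (rule negligible_subset) auto
    moreover have "?G differentiable_on ?B"
    proof (rule differentiable_at_imp_differentiable_on)
      fix s assume "s \<in> ?B"
      then have "0 < (y k + s *\<^sub>R e) \<bullet> e"
        using y(1)[of k] e by (simp add: inner_add_left dot_square_norm add_pos_pos)
      then have "y k + s *\<^sub>R e \<noteq> 0" by (metis inner_zero_left less_irrefl)
      then show "?G differentiable at s"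
        using norm_line_has_derivative real_differentiable_def by blast
    qed
    ultimately have "negligible (?G ` ?B)"
      by (intro negligible_differentiable_image_negligible) auto
    then have "AE t in lborel. t \<notin> ?G ` ?B"
      unfolding AE_lborel_iff_negligible by simp
    then show ?thesis
    proof eventually_elim
      case (elim t)
      show ?case
      proof
        assume t: "norm (y k) < t"
        have "(norm (y k))\<^sup>2 < t\<^sup>2" using t by (intro power_strict_mono) auto
        then have "sqrt ((y k \<bullet> e)\<^sup>2) < sqrt (t\<^sup>2 - (norm (y k))\<^sup>2 + (y k \<bullet> e)\<^sup>2)"
          by (intro real_sqrt_less_mono) linarith
        then have pos: "0 < \<sigma> k t" using y(1)[of k] by (simp add: \<sigma>_def)
        have "(\<sigma> k t + y k \<bullet> e)\<^sup>2 = t\<^sup>2 - (norm (y k))\<^sup>2 + (y k \<bullet> e)\<^sup>2"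
          using \<open>(norm (y k))\<^sup>2 < t\<^sup>2\<close> by (simp add: \<sigma>_def)
        moreover have "(?G (\<sigma> k t))\<^sup>2 = (norm (y k))\<^sup>2 - (y k \<bullet> e)\<^sup>2 + (\<sigma> k t + y k \<bullet> e)\<^sup>2"
          unfolding power2_norm_eq_inner
          using e by (simp add: inner_add_left inner_add_right norm_eq_1
              inner_commute power2_eq_square algebra_simps)
        ultimately have "(?G (\<sigma> k t))\<^sup>2 = t\<^sup>2" by simp
        then have G: "?G (\<sigma> k t) = t"
          using t norm_ge_zero[of "y k"] by (simp add: power2_eq_iff_nonneg)
        then have "f (y k + \<sigma> k t *\<^sub>R e) = f0 (y k + \<sigma> k t *\<^sub>R e)"
          using elim pos by (force simp: image_iff)
        then show "r k t = g t"
          using t G by (simp add: r_def fg)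
      qed
    qed
  qed
  define p where "p t = max 0 (lim (\<lambda>k. r k t))" for t
  have pm: "p \<in> borel_measurable borel" unfolding p_def by measurable
  have p0: "0 \<le> p t" for t by (simp add: p_def)
  have "AE t in lborel. \<forall>k. norm (y k) < t \<longrightarrow> r k t = g t"
    using rk by (simp add: AE_all_countable)
  then have pg: "AE t in lborel. 0 < t \<longrightarrow> p t = g t"
  proof eventually_elim
    case (elim t)
    show ?case
    proof
      assume "0 < t"
      have "(\<lambda>k. r k t) \<longlonglongrightarrow> g t"
      proof (rule tendsto_eventually)
        have "\<forall>\<^sub>F k in sequentially. 1 / real (Suc k) < t"
          using LIMSEQ_inverse_real_of_nat \<open>0 < t\<close>
          by (auto dest!: order_tendstoD(2) simp: inverse_eq_divide)
        then show "\<forall>\<^sub>F k in sequentially. r k t = g t"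
          by eventually_elim (use elim y(2) in \<open>meson less_trans\<close>)
      qed
      then show "p t = g t" using g[of t] by (simp add: p_def limI)
    qed
  qed
  obtain N where N: "N \<in> null_sets lborel" "{t. \<not> (0 < t \<longrightarrow> p t = g t)} \<subseteq> N"
    using pg by (auto elim!: AE_E simp: null_sets_def)
  have "AE x in (lborel :: 'a measure). x \<noteq> 0"
    by (rule AE_lborel_singleton)
  then have fp: "AE x in (lborel :: 'a measure). f x = p (norm x)"
    using radial_null[OF N(1), where 'a = 'a]
  proof eventually_elim
    case (elim x)
    then have "norm x \<notin> N" "0 < norm x" by auto
    then have "p (norm x) = g (norm x)" using N(2) by blast
    then show ?case by (simp add: fg)
  qed
  show thesis by (rule that[OF pm p0 pg fp])
qed

section \<open>Convolution with smooth compactly supported functions\<close>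

abbreviation partial_deriv :: "'n \<Rightarrow> (real^'n \<Rightarrow> real) \<Rightarrow> real^'n \<Rightarrow> real" where
  "partial_deriv i f \<equiv> \<lambda>x. frechet_derivative f (at x) (axis i 1)"

lemma C_inf_continuous: "C_inf f \<Longrightarrow> continuous_on UNIV f"
  unfolding C_inf_def by (metis C_diff.simps(1))

lemma C_inf_differentiable: "C_inf f \<Longrightarrow> f differentiable (at x)"
  unfolding C_inf_def by (metis C_diff.simps(2))

lemma C_inf_partial: "C_inf f \<Longrightarrow> C_inf (\<lambda>x. frechet_derivative f (at x) (axis i 1))"
  unfolding C_inf_def by (metis C_diff.simps(2))

definition zero_outside :: "real \<Rightarrow> ('a::real_normed_vector \<Rightarrow> 'b::zero) \<Rightarrow> bool" where
  "zero_outside R f \<longleftrightarrow> (\<forall>z. R < norm z \<longrightarrow> f z = 0)"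

lemma zero_outsideD: "zero_outside R f \<Longrightarrow> R < norm z \<Longrightarrow> f z = 0"
  by (simp add: zero_outside_def)

lemma zero_outside_partial:
  fixes f :: "real^'n \<Rightarrow> real"
  assumes "zero_outside R f"
  shows "zero_outside R (partial_deriv i f)"
  unfolding zero_outside_def
proof (intro allI impI)
  fix x :: "real^'n" assume x: "R < norm x"
  have "open {z :: real^'n. R < norm z}" by (intro open_Collect_less continuous_intros)
  then have "(f has_derivative (\<lambda>_. 0)) (at x)"
    using x assms
    by (intro has_derivative_transform_within_open[OF has_derivative_const[of 0]])
       (auto simp: zero_outside_def)
  then show "partial_deriv i f x = 0" by (metis frechet_derivative_at)
qed

lemma frechet_derivative_partials:
  fixes f :: "real^'n \<Rightarrow> real"
  assumes "f differentiable (at x)"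
  shows "frechet_derivative f (at x) h = (\<Sum>i\<in>UNIV. h $ i * partial_deriv i f x)"
proof -
  have lin: "linear (frechet_derivative f (at x))"
    by (rule linear_frechet_derivative[OF assms])
  have "frechet_derivative f (at x) h = frechet_derivative f (at x) (\<Sum>i\<in>UNIV. (h $ i) *\<^sub>R axis i 1)"
    using basis_expansion[of h] by (simp add: scalar_mult_eq_scaleR)
  also have "\<dots> = (\<Sum>i\<in>UNIV. h $ i * partial_deriv i f x)"
    by (simp add: linear_sum[OF lin] linear_cmul[OF lin])
  finally show ?thesis .
qed

lemma bounded_of_compact_support:
  fixes f :: "'a::euclidean_space \<Rightarrow> real"
  assumes f: "continuous_on UNIV f" and R: "zero_outside R f"
  obtains M where "0 \<le> M" "\<And>z. \<bar>f z\<bar> \<le> M"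
proof -
  have "compact (f ` cball 0 R)"
    by (intro compact_continuous_image continuous_on_subset[OF f]) auto
  then obtain M where M: "\<And>z. z \<in> cball 0 R \<Longrightarrow> \<bar>f z\<bar> \<le> M"
    by (fastforce dest!: compact_imp_bounded simp: bounded_iff)
  show thesis
  proof
    show "\<bar>f z\<bar> \<le> \<bar>M\<bar>" for z
      using M[of z] zero_outsideD[OF R, of z] by (cases "norm z \<le> R") auto
  qed simp
qed

text \<open>The partial derivatives are continuous with compact support, hence uniformly continuous, and the
  mean value inequality turns this into a uniform error bound. Uniformity in the base point is what
  allows differentiation under the integral against a kernel that is merely locally integrable.\<close>
lemma C1_linearization_uniform:
  fixes f :: "real^'n \<Rightarrow> real"
  assumes d: "\<And>x. f differentiable (at x)" and c: "\<And>i. continuous_on UNIV (partial_deriv i f)"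
    and R: "zero_outside R f" and "0 < \<epsilon>"
  shows "\<exists>\<delta>>0. \<forall>a b. norm (b - a) < \<delta> \<longrightarrow>
    \<bar>f b - f a - (\<Sum>i\<in>UNIV. (b - a) $ i * partial_deriv i f a)\<bar> \<le> \<epsilon> * norm (b - a)"
proof -
  define \<eta> where "\<eta> = \<epsilon> / real CARD('n)"
  have "0 < \<eta>" using \<open>0 < \<epsilon>\<close> by (simp add: \<eta>_def)
  have "\<exists>\<delta>>0. \<forall>a b. norm (b - a) < \<delta> \<longrightarrow> \<bar>partial_deriv i f b - partial_deriv i f a\<bar> \<le> \<eta>" for i
  proof -
    have "uniformly_continuous_on (cball 0 (R + 2)) (partial_deriv i f)"
      \<comment> \<open>The radius exceeds \<open>R\<close> by two, so that points at distance below one are either both in this ball or both outside the support.\<close>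
      by (intro compact_uniformly_continuous continuous_on_subset[OF c]) auto
    then obtain \<delta> where \<delta>: "0 < \<delta>" "\<And>a b. a \<in> cball 0 (R + 2) \<Longrightarrow> b \<in> cball 0 (R + 2) \<Longrightarrow>
        dist b a < \<delta> \<Longrightarrow> dist (partial_deriv i f b) (partial_deriv i f a) < \<eta>"
      using \<open>0 < \<eta>\<close> unfolding uniformly_continuous_on_def by metis
    have "\<bar>partial_deriv i f b - partial_deriv i f a\<bar> \<le> \<eta>" if ab: "norm (b - a) < min \<delta> 1" for a b
    proof (cases "norm a \<le> R + 1")
      case True
      have "norm b \<le> norm a + norm (b - a)" using norm_triangle_ineq[of a "b - a"] by simp
      with ab True have "a \<in> cball 0 (R + 2)" "b \<in> cball 0 (R + 2)" by auto
      then show ?thesis using \<delta>(2)[of a b] ab by (simp add: dist_norm)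
    next
      case False
      have "norm a \<le> norm b + norm (b - a)" using norm_triangle_ineq[of b "a - b"] by (simp add: norm_minus_commute)
      with ab False have "R < norm b" "R < norm a" by auto
      then show ?thesis using zero_outsideD[OF zero_outside_partial[OF R]] \<open>0 < \<eta>\<close> by simp
    qed
    then show ?thesis using \<delta>(1) by (intro exI[of _ "min \<delta> 1"]) auto
  qed
  then obtain \<delta> where \<delta>: "\<And>i. 0 < \<delta> i"
    "\<And>i a b. norm (b - a) < \<delta> i \<Longrightarrow> \<bar>partial_deriv i f b - partial_deriv i f a\<bar> \<le> \<eta>"
    by metis
  define \<delta>0 where "\<delta>0 = Min (range \<delta>)"
  have "0 < \<delta>0" using \<delta>(1) by (auto simp: \<delta>0_def)
  have \<delta>0: "\<delta>0 \<le> \<delta> i" for i by (simp add: \<delta>0_def)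
  show ?thesis
  proof (intro exI[of _ \<delta>0] conjI allI impI)
    show "0 < \<delta>0" by fact
    fix a b :: "real^'n" assume ab: "norm (b - a) < \<delta>0"
    have "norm (f b - f a - frechet_derivative f (at a) (b - a)) \<le> norm (b - a) * \<epsilon>"
    proof (rule differentiable_bound_linearization[where S = "ball a \<delta>0"])
      show "a + t *\<^sub>R (b - a) \<in> ball a \<delta>0" if "t \<in> {0..1}" for t
      proof -
        have "\<bar>t\<bar> * norm (b - a) \<le> 1 * norm (b - a)" using that by (intro mult_right_mono) auto
        then show ?thesis using ab by (simp add: dist_norm)
      qed
      show "(f has_derivative frechet_derivative f (at x)) (at x within ball a \<delta>0)" for x
        by (rule has_derivative_at_withinI, subst frechet_derivative_works[symmetric], rule d)
      show "a \<in> ball a \<delta>0" using \<open>0 < \<delta>0\<close> by simp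
      show "onorm (frechet_derivative f (at x) - frechet_derivative f (at a)) \<le> \<epsilon>"
        if "x \<in> ball a \<delta>0" for x
        unfolding fun_diff_def
      proof (rule onorm_le)
        fix h :: "real^'n"
        have "\<bar>partial_deriv i f x - partial_deriv i f a\<bar> \<le> \<eta>" for i
          using that \<delta>0[of i] by (intro \<delta>(2)) (simp add: dist_norm norm_minus_commute)
        then have "\<bar>h $ i * partial_deriv i f x - h $ i * partial_deriv i f a\<bar> \<le> norm h * \<eta>" for i
          unfolding right_diff_distrib[symmetric] abs_mult
          by (intro mult_mono component_le_norm_cart) auto
        then have "\<bar>\<Sum>i\<in>UNIV. h $ i * partial_deriv i f x - h $ i * partial_deriv i f a\<bar> \<le> (\<Sum>i\<in>(UNIV::'n set). norm h * \<eta>)"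
          by (intro order_trans[OF sum_abs] sum_mono)
        also have "\<dots> = \<epsilon> * norm h" by (simp add: \<eta>_def)
        finally show "norm (frechet_derivative f (at x) h - frechet_derivative f (at a) h) \<le> \<epsilon> * norm h"
          by (simp add: frechet_derivative_partials[OF d, of _ h] sum_subtractf)
      qed
    qed
    then show "\<bar>f b - f a - (\<Sum>i\<in>UNIV. (b - a) $ i * partial_deriv i f a)\<bar> \<le> \<epsilon> * norm (b - a)"
      by (simp add: frechet_derivative_partials[OF d, of a "b - a"] mult.commute)
  qed
qed

lemma conv_eq_lborel:
  fixes f :: "real^'n \<Rightarrow> 'b::euclidean_space"
  assumes [measurable]: "Q \<in> borel_measurable borel" "f \<in> borel_measurable borel"
  shows "conv Q f x = (\<integral>z. Q z *\<^sub>R f (x - z) \<partial>lborel)"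
proof -
  have "conv Q f x = (\<integral>y. Q (x - y) *\<^sub>R f y \<partial>lborel)"
    unfolding conv_def by (rule integral_completion) measurable
  also have "\<dots> = (\<integral>z. Q z *\<^sub>R f (x - z) \<partial>distr lborel borel (\<lambda>y. x - y))"
    by (subst integral_distr) auto
  finally show ?thesis by (simp add: lborel_distr_reflect)
qed

lemma conv_integrable:
  fixes f :: "'a::euclidean_space \<Rightarrow> real"
  assumes [measurable]: "Q \<in> borel_measurable borel"
    and loc: "\<And>r. integrable lborel (\<lambda>z. indicator (cball 0 r) z * Q z)"
    and f: "continuous_on UNIV f" and R: "zero_outside R f"
  shows "integrable lborel (\<lambda>z. Q z * f (x - z))"
proof -
  have [measurable]: "f \<in> borel_measurable borel" by (rule borel_measurable_continuous_onI[OF f])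
  obtain M where M: "0 \<le> M" "\<And>z. \<bar>f z\<bar> \<le> M" using bounded_of_compact_support[OF f R] by metis
  show ?thesis
  proof (rule Bochner_Integration.integrable_bound)
    show "integrable lborel (\<lambda>z. (indicator (cball 0 (norm x + R)) z * Q z) * M)"
      by (intro integrable_mult_left loc)
    show "AE z in lborel. norm (Q z * f (x - z)) \<le> norm ((indicator (cball 0 (norm x + R)) z * Q z) * M)"
    proof (rule AE_I2)
      fix z
      show "norm (Q z * f (x - z)) \<le> norm ((indicator (cball 0 (norm x + R)) z * Q z) * M)"
      proof (cases "norm z \<le> norm x + R")
        case True
        then show ?thesis using M by (simp add: abs_mult mult_left_mono)
      next
        case False
        have "norm z \<le> norm x + norm (x - z)" using norm_triangle_ineq4[of x "x - z"] by simp
        then show ?thesis using zero_outsideD[OF R, of "x - z"] False by simp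
      qed
    qed
  qed measurable
qed

text \<open>Writing the convolution with the shift on \<open>f\<close>, all difference quotients with increment of norm at most one
  are supported in one fixed ball, on which \<open>Q\<close> is integrable.\<close>
lemma conv_has_derivative:
  fixes f :: "real^'n \<Rightarrow> real"
  assumes Q[measurable]: "Q \<in> borel_measurable borel"
    and loc: "\<And>r. integrable lborel (\<lambda>z. indicator (cball 0 r) z * Q z)"
    and d: "\<And>x. f differentiable (at x)" and c: "\<And>i. continuous_on UNIV (partial_deriv i f)"
    and R: "zero_outside R f"
  shows "(conv Q f has_derivative (\<lambda>h. \<Sum>i\<in>UNIV. h $ i * conv Q (partial_deriv i f) x)) (at x)"
  unfolding has_derivative_at_alt
proof (intro conjI allI impI)
  show "bounded_linear (\<lambda>h. \<Sum>i\<in>UNIV. h $ i * conv Q (partial_deriv i f) x)"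
    by (rule bounded_linear_sum, rule bounded_linear_mult_const, rule bounded_linear_vec_nth)
  fix e :: real assume "0 < e"
  have f: "continuous_on UNIV f"
    using d by (simp add: continuous_at_imp_continuous_on differentiable_imp_continuous_within)
  have [measurable]: "f \<in> borel_measurable borel" "partial_deriv i f \<in> borel_measurable borel" for i
    by (auto intro!: borel_measurable_continuous_onI f c)
  have pdR: "zero_outside R (partial_deriv i f)" for i by (rule zero_outside_partial[OF R])
  define B :: "(real^'n) set" where "B = cball 0 (norm x + R + 1)"
  define I where "I = (\<integral>z. \<bar>indicator B z * Q z\<bar> \<partial>lborel)"
  have I: "0 \<le> I" by (simp add: I_def)
  have intB: "integrable lborel (\<lambda>z. \<bar>indicator B z * Q z\<bar>)"
    unfolding B_def by (intro integrable_abs loc)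
  define \<epsilon> where "\<epsilon> = e / (I + 1)"
  have "0 < \<epsilon>" using \<open>0 < e\<close> I by (simp add: \<epsilon>_def)
  obtain \<delta> where \<delta>: "0 < \<delta>" "\<And>a b. norm (b - a) < \<delta> \<Longrightarrow>
      \<bar>f b - f a - (\<Sum>i\<in>UNIV. (b - a) $ i * partial_deriv i f a)\<bar> \<le> \<epsilon> * norm (b - a)"
    using C1_linearization_uniform[OF d c R \<open>0 < \<epsilon>\<close>] by auto
  show "\<exists>d>0. \<forall>y. norm (y - x) < d \<longrightarrow>
      norm (conv Q f y - conv Q f x - (\<Sum>i\<in>UNIV. (y - x) $ i * conv Q (partial_deriv i f) x)) \<le> e * norm (y - x)"
  proof (intro exI[of _ "min \<delta> 1"] conjI allI impI)
    show "0 < min \<delta> 1" using \<delta> by simp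
    fix y assume y: "norm (y - x) < min \<delta> 1"
    let ?D = "\<lambda>z. Q z * f (y - z) - Q z * f (x - z) - (\<Sum>i\<in>UNIV. (y - x) $ i * (Q z * partial_deriv i f (x - z)))"
    have int1: "integrable lborel (\<lambda>z. Q z * f (a - z))" for a
      by (rule conv_integrable[OF Q loc f R])
    have int2: "integrable lborel (\<lambda>z. Q z * partial_deriv i f (x - z))" for i
      by (rule conv_integrable[OF Q loc c pdR])
    have "conv Q f y - conv Q f x - (\<Sum>i\<in>UNIV. (y - x) $ i * conv Q (partial_deriv i f) x) = (\<integral>z. ?D z \<partial>lborel)"
    proof -
      have int3: "integrable lborel (\<lambda>z. \<Sum>i\<in>UNIV. (y - x) $ i * (Q z * partial_deriv i f (x - z)))"
        by (intro Bochner_Integration.integrable_sum integrable_mult_right int2)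
      have "(\<integral>z. ?D z \<partial>lborel) = (\<integral>z. Q z * f (y - z) \<partial>lborel) - (\<integral>z. Q z * f (x - z) \<partial>lborel)
          - (\<integral>z. (\<Sum>i\<in>UNIV. (y - x) $ i * (Q z * partial_deriv i f (x - z))) \<partial>lborel)"
        by (simp only: Bochner_Integration.integral_diff Bochner_Integration.integrable_diff int1 int3)
      also have "(\<integral>z. (\<Sum>i\<in>UNIV. (y - x) $ i * (Q z * partial_deriv i f (x - z))) \<partial>lborel)
          = (\<Sum>i\<in>UNIV. (y - x) $ i * (\<integral>z. Q z * partial_deriv i f (x - z) \<partial>lborel))"
        by (subst Bochner_Integration.integral_sum) (intro integrable_mult_right int2, simp)
      finally show ?thesis by (simp add: conv_eq_lborel)
    qed
    also have "norm \<dots> \<le> (\<integral>z. \<bar>indicator B z * Q z\<bar> * (\<epsilon> * norm (y - x)) \<partial>lborel)"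
    proof (rule Bochner_Integration.integral_norm_bound_integral)
      show "integrable lborel ?D"
        by (intro Bochner_Integration.integrable_diff int1 Bochner_Integration.integrable_sum
            integrable_mult_right int2)
      show "integrable lborel (\<lambda>z. \<bar>indicator B z * Q z\<bar> * (\<epsilon> * norm (y - x)))"
        by (intro integrable_mult_left intB)
      fix z
      have D: "?D z = Q z * (f (y - z) - f (x - z) - (\<Sum>i\<in>UNIV. (y - x) $ i * partial_deriv i f (x - z)))"
        by (simp add: right_diff_distrib sum_distrib_left mult.left_commute)
      show "norm (?D z) \<le> \<bar>indicator B z * Q z\<bar> * (\<epsilon> * norm (y - x))"
      proof (cases "z \<in> B")
        case True
        have "\<bar>f (y - z) - f (x - z) - (\<Sum>i\<in>UNIV. (y - x) $ i * partial_deriv i f (x - z))\<bar> \<le> \<epsilon> * norm (y - x)"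
          using \<delta>(2)[of "y - z" "x - z"] y by simp
        then show ?thesis using True unfolding D by (simp add: abs_mult mult_left_mono)
      next
        case False
        have "norm z \<le> norm x + norm (x - z)" using norm_triangle_ineq4[of x "x - z"] by simp
        moreover have "norm (x - z) \<le> norm (y - z) + norm (y - x)"
          using norm_triangle_ineq4[of "y - z" "y - x"] by simp
        ultimately have "R < norm (x - z)" "R < norm (y - z)"
          using False y by (auto simp: B_def)
        then show ?thesis using \<open>0 < \<epsilon>\<close> by (simp add: zero_outsideD[OF R] zero_outsideD[OF pdR])
      qed
    qed
    also have "\<dots> = I * (\<epsilon> * norm (y - x))" by (simp add: I_def)
    also have "\<dots> = (I / (I + 1)) * (e * norm (y - x))" by (simp add: \<epsilon>_def)
    also have "\<dots> \<le> 1 * (e * norm (y - x))"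
      using I \<open>0 < e\<close> by (intro mult_right_mono) auto
    finally show "norm (conv Q f y - conv Q f x - (\<Sum>i\<in>UNIV. (y - x) $ i * conv Q (partial_deriv i f) x)) \<le> e * norm (y - x)"
      by simp
  qed
qed

lemma conv_partial:
  fixes f :: "real^'n \<Rightarrow> real"
  assumes Q: "Q \<in> borel_measurable borel"
    and loc: "\<And>r. integrable lborel (\<lambda>z. indicator (cball 0 r) z * Q z)"
    and f: "C_inf f" and R: "zero_outside R f"
  shows "conv Q f differentiable (at x)" "partial_deriv i (conv Q f) x = conv Q (partial_deriv i f) x"
proof -
  have der: "(conv Q f has_derivative (\<lambda>h. \<Sum>i\<in>UNIV. h $ i * conv Q (partial_deriv i f) x)) (at x)"
    by (rule conv_has_derivative[OF Q loc C_inf_differentiable[OF f] C_inf_continuous[OF C_inf_partial[OF f]] R])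
  then show "conv Q f differentiable (at x)" by (rule differentiableI)
  have "frechet_derivative (conv Q f) (at x) = (\<lambda>h. \<Sum>i\<in>UNIV. h $ i * conv Q (partial_deriv i f) x)"
    using frechet_derivative_at[OF der] by simp
  then show "partial_deriv i (conv Q f) x = conv Q (partial_deriv i f) x"
    by (simp add: axis_def if_distrib[of "\<lambda>a. a * _"] cong: if_cong)
qed

text \<open>Convolution with \<open>Q\<close> commutes with partial derivatives, and these are again smooth with support in
  the same ball, so the induction is on the order of differentiability for all such functions at once.\<close>
lemma conv_C_inf:
  fixes f :: "real^'n \<Rightarrow> real"
  assumes Q: "Q \<in> borel_measurable borel"
    and loc: "\<And>r. integrable lborel (\<lambda>z. indicator (cball 0 r) z * Q z)"
    and f: "C_inf f" and R: "zero_outside R f"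
  shows "C_inf (conv Q f)"
proof -
  have "C_diff k (conv Q f)" for k
    using f R
  proof (induction k arbitrary: f)
    case 0
    have "isCont (conv Q f) x" for x
      by (rule differentiable_imp_continuous_within[OF conv_partial(1)[OF Q loc 0]])
    then show ?case by (simp add: continuous_at_imp_continuous_on)
  next
    case (Suc k)
    have "C_diff k (partial_deriv i (conv Q f))" for i
      unfolding conv_partial(2)[OF Q loc Suc.prems]
      using Suc.IH[OF C_inf_partial[OF Suc.prems(1)] zero_outside_partial[OF Suc.prems(2)]] by simp
    then show ?case using conv_partial(1)[OF Q loc Suc.prems] by simp
  qed
  then show ?thesis by (simp add: C_inf_def)
qed

text \<open>The nonlocal gradient is handled one component at a time; this lemma puts the components together again.\<close>
lemma C_diff_vec:
  fixes F :: "real^'n \<Rightarrow> real^'m"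
  assumes "\<And>j. C_diff k (\<lambda>x. F x $ j)"
  shows "C_diff k F"
  using assms
proof (induction k arbitrary: F)
  case 0
  then have "continuous_on UNIV (\<lambda>x. \<chi> j. F x $ j)"
    by (intro continuous_on_vec_lambda) simp
  then show ?case by simp
next
  case (Suc k)
  have der: "(F has_derivative (\<lambda>h. \<chi> j. frechet_derivative (\<lambda>x. F x $ j) (at x) h)) (at x)" for x
    unfolding has_derivative_componentwise_within[of F]
    using Suc.prems by (auto simp: Basis_vec_def inner_axis frechet_derivative_works)
  then have "frechet_derivative F (at x) = (\<lambda>h. \<chi> j. frechet_derivative (\<lambda>x. F x $ j) (at x) h)" for x
    using frechet_derivative_at by metis
  moreover have "C_diff k (\<lambda>x. \<chi> j. frechet_derivative (\<lambda>x. F x $ j) (at x) (axis i 1))" for i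
    using Suc.prems by (intro Suc.IH) simp
  ultimately show ?case using der by (auto intro: differentiableI)
qed

section \<open>Increments of a test function\<close>

text \<open>A segment of length \<open>w \<bullet> c\<close> meets the ball of radius \<open>R\<close>, and that within a stretch bounded
  independently of \<open>w\<close>. The bound therefore behaves like \<open>|w|\<close> near the origin and is constant at infinity,
  which matches the weight \<open>min 1 (1 / |w|)\<close> in the integrability hypothesis on the kernel.\<close>
lemma line_integral_le_compact_support:
  fixes h :: "'a::euclidean_space \<Rightarrow> 'b::euclidean_space"
  assumes M: "0 \<le> M" "\<And>z. norm (h z) \<le> M" and R: "0 \<le> R" "zero_outside R h"
    and c: "norm c = 1" and w: "0 < w \<bullet> c"
  shows "(\<integral>\<^sup>+s. ennreal (norm (h (w - s *\<^sub>R c))) * indicator {0<..<w \<bullet> c} s \<partial>lborel)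
    \<le> ennreal (M * (2 * R + 1) * min 1 (norm w))"
proof -
  let ?I = "{max 0 (w \<bullet> c - R)..w \<bullet> c}"
  have wc: "w \<bullet> c \<le> norm w" using norm_cauchy_schwarz[of w c] c by simp
  have "(\<integral>\<^sup>+s. ennreal (norm (h (w - s *\<^sub>R c))) * indicator {0<..<w \<bullet> c} s \<partial>lborel)
      \<le> (\<integral>\<^sup>+s. ennreal M * indicator ?I s \<partial>lborel)"
  proof (intro nn_integral_mono)
    fix s
    show "ennreal (norm (h (w - s *\<^sub>R c))) * indicator {0<..<w \<bullet> c} s \<le> ennreal M * indicator ?I s"
    proof (cases "s \<in> {0<..<w \<bullet> c}")
      case True
      show ?thesis
      proof (cases "w \<bullet> c - R \<le> s")
        case True
        then show ?thesis using M \<open>s \<in> {0<..<w \<bullet> c}\<close> by (auto intro: ennreal_leI)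
      next
        case False
        have "(w - s *\<^sub>R c) \<bullet> c = w \<bullet> c - s" using c by (simp add: inner_diff_left norm_eq_1)
        then have "w \<bullet> c - s \<le> norm (w - s *\<^sub>R c)"
          using norm_cauchy_schwarz[of "w - s *\<^sub>R c" c] c by simp
        then have "R < norm (w - s *\<^sub>R c)" using False by simp
        then show ?thesis using zero_outsideD[OF R(2)] by simp
      qed
    qed simp
  qed
  also have "\<dots> = ennreal M * ennreal (min (w \<bullet> c) R)"
    using w R(1) by (simp add: nn_integral_cmult_indicator min_def max_def)
  also have "\<dots> \<le> ennreal (M * (2 * R + 1) * min 1 (norm w))"
  proof -
    have "min (w \<bullet> c) R \<le> (2 * R + 1) * min 1 (norm w)"
    proof (cases "norm w \<le> 1")
      case True
      have "1 * norm w \<le> (2 * R + 1) * norm w" using R(1) by (intro mult_right_mono) auto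
      then show ?thesis using True wc by simp
    next
      case False
      then show ?thesis using R(1) by simp
    qed
    then have "M * min (w \<bullet> c) R \<le> M * ((2 * R + 1) * min 1 (norm w))"
      using M(1) by (intro mult_left_mono) auto
    then show ?thesis using M(1) by (simp add: mult.assoc ennreal_leI flip: ennreal_mult')
  qed
  finally show ?thesis .
qed

text \<open>The space enters only through its dimension, which the profile does not determine; hence the type argument.\<close>
definition admissible :: "'a::euclidean_space itself \<Rightarrow> (real \<Rightarrow> real) \<Rightarrow> bool" where
  "admissible _ p \<longleftrightarrow> p \<in> borel_measurable borel \<and> (\<forall>t. 0 \<le> p t) \<and>
    (\<integral>\<^sup>+w. ennreal (p (norm w) * min 1 (1 / norm w)) \<partial>(lborel :: 'a measure)) < \<infinity>"

lemma admissible_measurable [measurable_dest]: "admissible TYPE('a::euclidean_space) p \<Longrightarrow> p \<in> borel_measurable borel"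
  by (simp add: admissible_def)

lemma admissible_nonneg: "admissible TYPE('a::euclidean_space) p \<Longrightarrow> 0 \<le> p t"
  by (simp add: admissible_def)

lemma admissible_finite:
  assumes p: "admissible TYPE('a::euclidean_space) p" and C: "0 \<le> C"
  shows "(\<integral>\<^sup>+w. ennreal (p (norm w) / norm w * (C * min 1 (norm w))) \<partial>(lborel :: 'a measure)) < \<infinity>"
proof -
  have [measurable]: "p \<in> borel_measurable borel" using p by measurable
  have "(\<integral>\<^sup>+w. ennreal (p (norm w) / norm w * (C * min 1 (norm w))) \<partial>(lborel :: 'a measure))
      \<le> (\<integral>\<^sup>+w. ennreal C * ennreal (p (norm w) * min 1 (1 / norm w)) \<partial>(lborel :: 'a measure))"
  proof (intro nn_integral_mono)
    fix w :: 'a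
    have "p (norm w) / norm w * (C * min 1 (norm w)) \<le> C * (p (norm w) * min 1 (1 / norm w))"
      using C admissible_nonneg[OF p, of "norm w"] by (cases "w = 0") (auto simp: min_def field_simps)
    then show "ennreal (p (norm w) / norm w * (C * min 1 (norm w)))
        \<le> ennreal C * ennreal (p (norm w) * min 1 (1 / norm w))"
      using C by (simp add: ennreal_leI flip: ennreal_mult')
  qed
  also have "\<dots> = ennreal C * (\<integral>\<^sup>+w. ennreal (p (norm w) * min 1 (1 / norm w)) \<partial>(lborel :: 'a measure))"
    by (rule nn_integral_cmult) measurable
  also have "\<dots> < \<infinity>"
    using p by (auto simp: admissible_def ennreal_mult_less_top)
  finally show ?thesis .
qed

lemma tail_locally_integrable:
  assumes p: "admissible TYPE('a::euclidean_space) p"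
  shows "integrable lborel (\<lambda>z::'a. indicator (cball 0 r) z * tail_ker p z)"
proof -
  obtain e :: 'a where "e \<in> Basis" using SOME_Basis by blast
  then have e: "norm e = 1" by simp
  define R where "R = max 0 r"
  let ?h = "indicator (cball 0 r) :: 'a \<Rightarrow> real"
  have pm: "p \<in> borel_measurable borel" using p by measurable
  have hm: "?h \<in> borel_measurable borel" by (intro borel_measurable_indicator borel_closed closed_cball)
  have "integrable lborel (\<lambda>z. tail_ker p z *\<^sub>R ?h z)"
  proof (rule both_halfspaces_integral(1)[where m = "\<lambda>t. 1 * (2 * R + 1) * min 1 \<bar>t\<bar>", OF pm admissible_nonneg[OF p] e hm])
    fix c w :: 'a assume cw: "norm c = 1" "0 < w \<bullet> c"
    have "zero_outside R ?h" by (auto simp: zero_outside_def R_def indicator_def)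
    then show "(\<integral>\<^sup>+s. ennreal (norm (?h (w - s *\<^sub>R c))) * indicator {0<..<w \<bullet> c} s \<partial>lborel)
        \<le> ennreal (1 * (2 * R + 1) * min 1 \<bar>norm w\<bar>)"
      using line_integral_le_compact_support[of 1 ?h R c w] cw by (simp add: R_def indicator_def)
  next
    show "(\<integral>\<^sup>+w. ennreal (p (norm w) / norm w * (1 * (2 * R + 1) * min 1 \<bar>norm w\<bar>)) \<partial>(lborel :: 'a measure)) < \<infinity>"
      using admissible_finite[OF p, of "2 * R + 1"] by (simp add: R_def)
  qed (simp add: R_def)
  then show ?thesis by (simp add: mult.commute)
qed

text \<open>The function is Lipschitz, which is the better bound for nearby points, and bounded, which is the better bound for
  distant ones. The minimum is what makes increments integrable against \<open>line_ker\<close> both at the origin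
  and at infinity.\<close>
lemma smooth_increment_bound:
  fixes u :: "real^'n \<Rightarrow> real"
  assumes u: "C_inf u" and R: "zero_outside R u"
  obtains C where "0 \<le> C" "\<And>a b. \<bar>u a - u b\<bar> \<le> C * min 1 (norm (a - b))"
proof -
  obtain M where M: "0 \<le> M" "\<And>z. \<bar>u z\<bar> \<le> M"
    using bounded_of_compact_support[OF C_inf_continuous[OF u] R] by metis
  have "\<exists>L. 0 \<le> L \<and> (\<forall>z. \<bar>partial_deriv i u z\<bar> \<le> L)" for i
    using bounded_of_compact_support[OF C_inf_continuous[OF C_inf_partial[OF u]] zero_outside_partial[OF R]] by metis
  then obtain L where L: "\<And>i. 0 \<le> L i" "\<And>i z. \<bar>partial_deriv i u z\<bar> \<le> L i" by metis
  define S where "S = sum L UNIV"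
  have S: "0 \<le> S" using L(1) by (simp add: S_def sum_nonneg)
  have lip: "\<bar>u a - u b\<bar> \<le> S * norm (a - b)" for a b
  proof -
    have "norm (u a - u b) \<le> S * norm (a - b)"
    proof (rule differentiable_bound[where S = UNIV and f' = "\<lambda>x. frechet_derivative u (at x)"])
      show "(u has_derivative frechet_derivative u (at x)) (at x)" for x
        using C_inf_differentiable[OF u] frechet_derivative_works by blast
      show "onorm (frechet_derivative u (at x)) \<le> S" for x
      proof (rule onorm_le)
        fix h :: "real^'n"
        have "norm (frechet_derivative u (at x) h) = \<bar>\<Sum>i\<in>UNIV. h $ i * partial_deriv i u x\<bar>"
          by (simp add: frechet_derivative_partials[OF C_inf_differentiable[OF u], of x h])
        also have "\<dots> \<le> (\<Sum>i\<in>UNIV. L i * norm h)"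
          using L component_le_norm_cart[of h]
          by (intro order_trans[OF sum_abs] sum_mono, unfold abs_mult mult.commute[of "L _"])
             (intro mult_mono, auto)
        finally show "norm (frechet_derivative u (at x) h) \<le> S * norm h"
          by (simp add: S_def sum_distrib_right)
      qed
    qed auto
    then show ?thesis by simp
  qed
  show thesis
  proof
    show "0 \<le> max S (2 * M)" using S by simp
    show "\<bar>u a - u b\<bar> \<le> max S (2 * M) * min 1 (norm (a - b))" for a b
    proof (cases "norm (a - b) \<le> 1")
      case True
      then show ?thesis using lip[of a b] mult_right_mono[of S "max S (2 * M)" "norm (a - b)"] by simp
    next
      case False
      then show ?thesis using M(2)[of a] M(2)[of b] by auto
    qed
  qed
qed

text \<open>The case \<open>v z = - u (x - z)\<close> of the integration by parts.\<close>
lemma conv_tail_partial: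
  fixes u :: "real^'n \<Rightarrow> real"
  assumes p: "admissible TYPE(real^'n) p" and u: "C_inf u" and R: "zero_outside R u"
  shows "integrable lborel (\<lambda>w. line_ker p (axis j 1) w * (u x - u (x - w)))"
    and "conv (tail_ker p) (partial_deriv j u) x = (\<integral>w. line_ker p (axis j 1) w * (u x - u (x - w)) \<partial>lborel)"
proof -
  let ?e = "axis j 1 :: real^'n"
  define h where "h z = partial_deriv j u (x - z)" for z
  define v where "v z = - u (x - z)" for z
  have pm[measurable]: "p \<in> borel_measurable borel" using p by measurable
  have cu: "continuous_on UNIV u" and cpu: "continuous_on UNIV (partial_deriv j u)"
    by (intro C_inf_continuous u C_inf_partial)+
  have h: "continuous_on UNIV h" and cv: "continuous_on UNIV v"
    unfolding h_def v_def
    by (intro continuous_intros continuous_on_compose2[OF cpu] continuous_on_compose2[OF cu]; simp)+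
  obtain M where M: "0 \<le> M" "\<And>z. \<bar>partial_deriv j u z\<bar> \<le> M"
    using bounded_of_compact_support[OF cpu zero_outside_partial[OF R]] by metis
  obtain C where C: "0 \<le> C" "\<And>a b. \<bar>u a - u b\<bar> \<le> C * min 1 (norm (a - b))"
    using smooth_increment_bound[OF u R] by metis
  define R' where "R' = norm x + \<bar>R\<bar>"
  have hR': "zero_outside R' h"
    unfolding zero_outside_def h_def
  proof (intro allI impI)
    fix z :: "real^'n" assume "R' < norm z"
    moreover have "norm z \<le> norm x + norm (x - z)" using norm_triangle_ineq4[of x "x - z"] by simp
    ultimately have "R < norm (x - z)" by (simp add: R'_def)
    then show "partial_deriv j u (x - z) = 0" by (rule zero_outsideD[OF zero_outside_partial[OF R]])
  qed
  define D where "D = M * (2 * R' + 1) + C"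
  have D: "0 \<le> D" "M * (2 * R' + 1) \<le> D" "C \<le> D"
    using M(1) C(1) by (auto simp: D_def R'_def)
  have deriv: "((\<lambda>s. v (a + s *\<^sub>R ?e)) has_vector_derivative h (a + s *\<^sub>R ?e)) (at s)" for a s
  proof -
    let ?y = "x - (a + s *\<^sub>R ?e)"
    have lin: "linear (frechet_derivative u (at ?y))"
      by (rule linear_frechet_derivative[OF C_inf_differentiable[OF u]])
    have du: "(u has_derivative frechet_derivative u (at ?y)) (at ?y)"
      by (subst frechet_derivative_works[symmetric]) (rule C_inf_differentiable[OF u])
    have "((\<lambda>s. x - (a + s *\<^sub>R ?e)) has_derivative (\<lambda>t. - (t *\<^sub>R ?e))) (at s)"
      by (auto intro!: derivative_eq_intros)
    from has_derivative_minus[OF has_derivative_compose[OF this du]]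
    have "(v \<circ> (\<lambda>s. a + s *\<^sub>R ?e) has_derivative (\<lambda>t. - frechet_derivative u (at ?y) (- (t *\<^sub>R ?e)))) (at s)"
      by (simp add: v_def o_def)
    also have "(\<lambda>t. - frechet_derivative u (at ?y) (- (t *\<^sub>R ?e))) = (\<lambda>t. t *\<^sub>R h (a + s *\<^sub>R ?e))"
      by (simp add: h_def linear_neg[OF lin] linear_cmul[OF lin])
    finally show ?thesis by (simp add: has_vector_derivative_def o_def)
  qed
  have bound: "(\<integral>\<^sup>+s. ennreal (norm (h (w - s *\<^sub>R c))) * indicator {0<..<w \<bullet> c} s \<partial>lborel)
      \<le> ennreal (D * min 1 \<bar>norm w\<bar>)" if "norm c = 1" "0 < w \<bullet> c" for c w
  proof -
    have "M * (2 * R' + 1) * min 1 (norm w) \<le> D * min 1 (norm w)"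
      using D(2) by (rule mult_right_mono) simp
    then show ?thesis
      using line_integral_le_compact_support[of M h R' c w] hR' M that
      by (simp add: h_def R'_def order_trans[OF _ ennreal_leI])
  qed
  have vbound: "norm (v w - v 0) \<le> D * min 1 \<bar>norm w\<bar>" for w
    using C(2)[of x "x - w"] mult_right_mono[OF D(3), of "min 1 (norm w)"]
    by (simp add: v_def)
  have fin: "(\<integral>\<^sup>+w. ennreal (p (norm w) / norm w * (D * min 1 \<bar>norm w\<bar>)) \<partial>(lborel :: (real^'n) measure)) < \<infinity>"
    using admissible_finite[OF p D(1)] by simp
  have vm: "v \<in> borel_measurable borel" by (rule borel_measurable_continuous_onI[OF cv])
  have e: "norm ?e = 1" by simp
  note by_parts = kernel_integral_by_parts[of p ?e h v "\<lambda>t. D * min 1 \<bar>t\<bar>",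
      OF pm admissible_nonneg[OF p] e h deriv bound vbound vm fin]
  have v0: "v w - v 0 = u x - u (x - w)" for w by (simp add: v_def)
  show "integrable lborel (\<lambda>w. line_ker p ?e w * (u x - u (x - w)))"
    using by_parts(1) D(1) by (simp add: v0)
  have "conv (tail_ker p) (partial_deriv j u) x = (\<integral>z. tail_ker p z *\<^sub>R h z \<partial>lborel)"
    unfolding h_def by (rule conv_eq_lborel) (auto intro: borel_measurable_continuous_onI[OF cpu])
  also have "\<dots> = (\<integral>w. line_ker p ?e w * (u x - u (x - w)) \<partial>lborel)"
    using by_parts(2) D(1) by (simp add: v0)
  finally show "conv (tail_ker p) (partial_deriv j u) x = (\<integral>w. line_ker p ?e w * (u x - u (x - w)) \<partial>lborel)" .
qed

section \<open>Integrable profiles and Fourier transforms\<close>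

definition L1_profile :: "'a::euclidean_space itself \<Rightarrow> (real \<Rightarrow> real) \<Rightarrow> bool" where
  "L1_profile _ p \<longleftrightarrow> p \<in> borel_measurable borel \<and> (\<forall>t. 0 \<le> p t) \<and>
    (\<integral>\<^sup>+w. ennreal (p (norm w)) \<partial>(lborel :: 'a measure)) < \<infinity>"

lemma L1_profile_measurable: "L1_profile TYPE('a::euclidean_space) p \<Longrightarrow> p \<in> borel_measurable borel"
  by (simp add: L1_profile_def)

lemma L1_profile_nonneg: "L1_profile TYPE('a::euclidean_space) p \<Longrightarrow> 0 \<le> p t"
  by (simp add: L1_profile_def)

lemma L1_profile_finite:
  assumes p: "L1_profile TYPE('a::euclidean_space) p" and M: "0 \<le> M"
  shows "(\<integral>\<^sup>+w. ennreal (p (norm w) / norm w * (M * \<bar>norm w\<bar>)) \<partial>(lborel :: 'a measure)) < \<infinity>"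
proof -
  have [measurable]: "p \<in> borel_measurable borel" by (rule L1_profile_measurable[OF p])
  have "(\<integral>\<^sup>+w. ennreal (p (norm w) / norm w * (M * \<bar>norm w\<bar>)) \<partial>(lborel :: 'a measure))
      \<le> (\<integral>\<^sup>+w. ennreal M * ennreal (p (norm w)) \<partial>(lborel :: 'a measure))"
  proof (intro nn_integral_mono)
    fix w :: 'a
    have "p (norm w) / norm w * (M * \<bar>norm w\<bar>) \<le> M * p (norm w)"
      using M L1_profile_nonneg[OF p, of "norm w"] by (cases "w = 0") auto
    then show "ennreal (p (norm w) / norm w * (M * \<bar>norm w\<bar>)) \<le> ennreal M * ennreal (p (norm w))"
      using M by (simp add: ennreal_leI flip: ennreal_mult')
  qed
  also have "\<dots> = ennreal M * (\<integral>\<^sup>+w. ennreal (p (norm w)) \<partial>(lborel :: 'a measure))"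
    by (rule nn_integral_cmult) measurable
  also have "\<dots> < \<infinity>"
    using p by (auto simp: L1_profile_def ennreal_mult_less_top)
  finally show ?thesis .
qed

lemma line_integral_le_bounded:
  fixes h :: "'a::euclidean_space \<Rightarrow> 'b::real_normed_vector"
  assumes M: "0 \<le> M" "\<And>z. norm (h z) \<le> M" and c: "norm c = 1" and w: "0 < w \<bullet> c"
  shows "(\<integral>\<^sup>+s. ennreal (norm (h (w - s *\<^sub>R c))) * indicator {0<..<w \<bullet> c} s \<partial>lborel)
    \<le> ennreal (M * \<bar>norm w\<bar>)"
proof -
  have wc: "w \<bullet> c \<le> norm w" using norm_cauchy_schwarz[of w c] c by simp
  have "(\<integral>\<^sup>+s. ennreal (norm (h (w - s *\<^sub>R c))) * indicator {0<..<w \<bullet> c} s \<partial>lborel)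
      \<le> (\<integral>\<^sup>+s. ennreal M * indicator {0<..<w \<bullet> c} s \<partial>lborel)"
    using M by (intro nn_integral_mono mult_right_mono ennreal_leI) auto
  also have "\<dots> = ennreal M * ennreal (w \<bullet> c)"
    using w by (simp add: nn_integral_cmult_indicator)
  also have "\<dots> \<le> ennreal (M * \<bar>norm w\<bar>)"
    using M(1) wc by (simp add: ennreal_leI mult_left_mono flip: ennreal_mult')
  finally show ?thesis .
qed

lemma tail_integrable:
  assumes p: "L1_profile TYPE('a::euclidean_space) p"
  shows "integrable lborel (\<lambda>z::'a. tail_ker p z)"
proof -
  obtain e :: 'a where "e \<in> Basis" using SOME_Basis by blast
  then have e: "norm e = 1" by simp
  have hm: "(\<lambda>_::'a. 1::real) \<in> borel_measurable borel" by simp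
  have "integrable lborel (\<lambda>z::'a. tail_ker p z *\<^sub>R (1::real))"
  proof (rule both_halfspaces_integral(1)[where m = "\<lambda>t. 1 * \<bar>t\<bar>", OF L1_profile_measurable[OF p] L1_profile_nonneg[OF p] e hm])
    show "(\<integral>\<^sup>+w. ennreal (p (norm w) / norm w * (1 * \<bar>norm w\<bar>)) \<partial>(lborel :: 'a measure)) < \<infinity>"
      by (rule L1_profile_finite[OF p]) simp
    show "(\<integral>\<^sup>+s. ennreal (norm (1::real)) * indicator {0<..<w \<bullet> c} s \<partial>lborel) \<le> ennreal (1 * \<bar>norm w\<bar>)"
      if "norm c = 1" "0 < w \<bullet> c" for c w :: 'a
      using line_integral_le_bounded[of 1 "\<lambda>_::'a. 1::real" c w] that by simp
  qed simp
  then show ?thesis by simp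
qed

text \<open>If the profile is integrable then \<open>h\<close> need only be bounded: the line integrals grow at most
  linearly in \<open>|w|\<close>, which cancels the singular factor \<open>1 / |w|\<close>.\<close>
lemma kernel_integral_by_parts_bounded:
  fixes h v :: "'a::euclidean_space \<Rightarrow> 'b::euclidean_space"
  assumes p: "L1_profile TYPE('a) p" and e: "norm e = 1" and h: "continuous_on UNIV h"
    and v: "\<And>a s. ((\<lambda>s. v (a + s *\<^sub>R e)) has_vector_derivative h (a + s *\<^sub>R e)) (at s)"
    and M: "0 \<le> M" "\<And>z. norm (h z) \<le> M" and vM: "\<And>w. norm (v w - v 0) \<le> M * norm w"
    and vm: "continuous_on UNIV v"
  shows "integrable lborel (\<lambda>w. line_ker p e w *\<^sub>R (v w - v 0))"
    and "(\<integral>z. tail_ker p z *\<^sub>R h z \<partial>lborel) = (\<integral>w. line_ker p e w *\<^sub>R (v w - v 0) \<partial>lborel)"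
proof -
  have vM': "norm (v w - v 0) \<le> M * \<bar>norm w\<bar>" for w using vM[of w] by simp
  have m: "0 \<le> M * \<bar>r\<bar>" for r using M(1) by simp
  have fin: "(\<integral>\<^sup>+w. ennreal (p (norm w) / norm w * (M * \<bar>norm w\<bar>)) \<partial>(lborel :: 'a measure)) < \<infinity>"
    by (rule L1_profile_finite[OF p M(1)])
  note vm' = borel_measurable_continuous_onI[OF vm]
  show "integrable lborel (\<lambda>w. line_ker p e w *\<^sub>R (v w - v 0))"
    by (rule kernel_integral_by_parts(1)[of p e h v "\<lambda>t. M * \<bar>t\<bar>",
          OF L1_profile_measurable[OF p] L1_profile_nonneg[OF p] e h v
            line_integral_le_bounded[OF M] vM' vm' fin m])
  show "(\<integral>z. tail_ker p z *\<^sub>R h z \<partial>lborel) = (\<integral>w. line_ker p e w *\<^sub>R (v w - v 0) \<partial>lborel)"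
    by (rule kernel_integral_by_parts(2)[of p e h v "\<lambda>t. M * \<bar>t\<bar>",
          OF L1_profile_measurable[OF p] L1_profile_nonneg[OF p] e h v
            line_integral_le_bounded[OF M] vM' vm' fin m])
qed

lemma integral_lborel_uminus:
  fixes f :: "'a::euclidean_space \<Rightarrow> 'b::{banach, second_countable_topology}"
  assumes [measurable]: "f \<in> borel_measurable borel"
  shows "(\<integral>x. f (- x) \<partial>lborel) = (\<integral>x. f x \<partial>lborel)"
proof -
  have "(\<integral>x. f x \<partial>lborel) = (\<integral>x. f x \<partial>distr lborel borel (\<lambda>x. 0 - x))"
    by (simp only: lborel_distr_reflect)
  also have "\<dots> = (\<integral>x. f (0 - x) \<partial>lborel)" by (rule integral_distr) simp_all
  finally show ?thesis by simp
qed

text \<open>The sign is opposite to that in the definition of \<open>fourier\<close>, in accordance with the symbol \<open>lam\<close>.\<close>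
definition fourier_char :: "real^'n \<Rightarrow> real^'n \<Rightarrow> complex" where
  "fourier_char \<xi> x = exp (\<i> * complex_of_real (2 * pi * (x \<bullet> \<xi>)))"

lemma continuous_on_fourier_char [continuous_intros]: "continuous_on S (fourier_char \<xi>)"
  unfolding fourier_char_def by (intro continuous_intros)

lemma fourier_char_measurable [measurable]: "fourier_char \<xi> \<in> borel_measurable borel"
  by (intro borel_measurable_continuous_onI continuous_on_fourier_char)

lemma norm_fourier_char [simp]: "norm (fourier_char \<xi> x) = 1"
  unfolding fourier_char_def by (rule norm_exp_i_times)

lemma fourier_char_0 [simp]: "fourier_char \<xi> 0 = 1" by (simp add: fourier_char_def)

lemma fourier_char_add: "fourier_char \<xi> (x + y) = fourier_char \<xi> x * fourier_char \<xi> y"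
  by (simp add: fourier_char_def inner_add_left algebra_simps flip: exp_add)

lemma fourier_eq_fourier_char:
  fixes f :: "real^'n \<Rightarrow> real"
  assumes [measurable]: "f \<in> borel_measurable borel"
  shows "fourier f \<xi> = (\<integral>x. f x *\<^sub>R fourier_char \<xi> (- x) \<partial>lborel)"
proof -
  have "fourier f \<xi> = (\<integral>x. f x *\<^sub>R fourier_char \<xi> (- x) \<partial>lebesgue)"
    unfolding fourier_def fourier_char_def by (simp add: scaleR_conv_of_real mult_ac)
  also have "\<dots> = (\<integral>x. f x *\<^sub>R fourier_char \<xi> (- x) \<partial>lborel)"
    by (rule integral_completion) measurable
  finally show ?thesis .
qed

text \<open>The tail kernel is even, so the sign in the exponent is immaterial.\<close>
lemma fourier_tail:
  assumes [measurable]: "p \<in> borel_measurable borel"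
  shows "fourier (\<lambda>z. tail_ker p z) \<xi> = (\<integral>x. tail_ker p x *\<^sub>R fourier_char \<xi> x \<partial>lborel)"
  using integral_lborel_uminus[of "\<lambda>x. tail_ker p x *\<^sub>R fourier_char \<xi> x"]
  by (simp add: fourier_eq_fourier_char)

text \<open>The case where \<open>v\<close> is the character \<open>exp (2 \<pi> i \<xi> \<bullet> z)\<close>, with derivative \<open>2 \<pi> i \<xi>\<^sub>j v\<close> in direction
  \<open>j\<close>.\<close>
lemma fourier_tail_component:
  fixes \<xi> :: "real^'n"
  assumes p: "L1_profile TYPE(real^'n) p"
  shows "integrable lborel (\<lambda>w. line_ker p (axis j 1) w *\<^sub>R (fourier_char \<xi> w - 1))"
    and "(\<integral>w. line_ker p (axis j 1) w *\<^sub>R (fourier_char \<xi> w - 1) \<partial>lborel)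
      = 2 * pi * \<i> * fourier (\<lambda>z. tail_ker p z) \<xi> * complex_of_real (\<xi> $ j)"
proof -
  let ?e = "axis j 1 :: real^'n"
  let ?c = "2 * pi * \<i> * complex_of_real (\<xi> $ j)"
  have pm[measurable]: "p \<in> borel_measurable borel" by (rule L1_profile_measurable[OF p])
  have deriv: "((\<lambda>s. fourier_char \<xi> (a + s *\<^sub>R ?e)) has_vector_derivative ?c * fourier_char \<xi> (a + s *\<^sub>R ?e)) (at s)" for a s
  proof -
    have "((\<lambda>s. exp (\<i> * complex_of_real (2 * pi * (a \<bullet> \<xi> + s * \<xi> $ j)))) has_vector_derivative
        ?c * exp (\<i> * complex_of_real (2 * pi * (a \<bullet> \<xi> + s * \<xi> $ j)))) (at s)"
    proof -
      let ?f = "\<lambda>z. exp (\<i> * (2 * pi * (complex_of_real (a \<bullet> \<xi>) + z * complex_of_real (\<xi> $ j))))"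
      have "(?f has_field_derivative ?c * ?f (complex_of_real s)) (at (complex_of_real s))"
        by (auto intro!: derivative_eq_intros)
      from has_vector_derivative_real_field[OF this] show ?thesis by simp
    qed
    then show ?thesis by (simp add: fourier_char_def inner_add_left inner_axis')
  qed
  have nc: "norm ?c \<le> 2 * pi * norm \<xi>"
    using component_le_norm_cart[of \<xi> j] by (simp add: norm_mult)
  have lip: "norm (fourier_char \<xi> w - 1) \<le> 2 * pi * norm \<xi> * norm w" for w
  proof -
    have "norm (fourier_char \<xi> w - 1) = 2 * \<bar>sin (2 * pi * (w \<bullet> \<xi>) / 2)\<bar>"
      unfolding fourier_char_def by (rule dist_exp_i_1)
    also have "\<dots> \<le> 2 * \<bar>2 * pi * (w \<bullet> \<xi>) / 2\<bar>"
      by (intro mult_left_mono abs_sin_x_le_abs_x) auto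
    also have "\<dots> \<le> 2 * pi * (norm w * norm \<xi>)"
      using Cauchy_Schwarz_ineq2[of w \<xi>] by (simp add: abs_mult)
    finally show ?thesis by (simp add: mult_ac)
  qed
  have 1: "norm ?e = 1" "continuous_on UNIV (\<lambda>z. ?c * fourier_char \<xi> z)" "0 \<le> 2 * pi * norm \<xi>"
    by (auto intro!: continuous_intros)
  have 2: "norm (?c * fourier_char \<xi> z) \<le> 2 * pi * norm \<xi>" for z
    unfolding norm_mult[of ?c] using nc by simp
  have 3: "norm (fourier_char \<xi> w - fourier_char \<xi> 0) \<le> 2 * pi * norm \<xi> * norm w" for w
    using lip[of w] by simp
  note by_parts = kernel_integral_by_parts_bounded[OF p 1(1,2) deriv 1(3) 2 3 continuous_on_fourier_char]
  show "integrable lborel (\<lambda>w. line_ker p ?e w *\<^sub>R (fourier_char \<xi> w - 1))"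
    using by_parts(1) by simp
  have "(\<integral>w. line_ker p ?e w *\<^sub>R (fourier_char \<xi> w - 1) \<partial>lborel) = (\<integral>z. tail_ker p z *\<^sub>R (?c * fourier_char \<xi> z) \<partial>lborel)"
    using by_parts(2) by simp
  also have "\<dots> = (\<integral>z. ?c * (tail_ker p z *\<^sub>R fourier_char \<xi> z) \<partial>lborel)"
    by (simp only: mult_scaleR_right)
  also have "\<dots> = ?c * (\<integral>z. tail_ker p z *\<^sub>R fourier_char \<xi> z \<partial>lborel)"
    by (rule integral_mult_right_zero)
  finally show "(\<integral>w. line_ker p ?e w *\<^sub>R (fourier_char \<xi> w - 1) \<partial>lborel)
      = 2 * pi * \<i> * fourier (\<lambda>z. tail_ker p z) \<xi> * complex_of_real (\<xi> $ j)"
    by (simp add: fourier_tail mult_ac)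
qed

text \<open>An orthogonal map takes \<open>|\<xi>| e\<^sub>k\<close> to \<open>\<xi>\<close> and leaves the kernel unchanged. Evenness reduces the exponential to a
  cosine, which is the derivative in direction \<open>k\<close> of \<open>sin (2 \<pi> |\<xi>| z\<^sub>k) / (2 \<pi> |\<xi>|)\<close>.\<close>
lemma fourier_tail_radial:
  fixes \<xi> :: "real^'n" and k :: 'n
  assumes p: "L1_profile TYPE(real^'n) p" and \<xi>: "\<xi> \<noteq> 0"
  shows "fourier (\<lambda>z. tail_ker p z) \<xi> = complex_of_real (1 / (2 * pi * norm \<xi>) *
    (\<integral>w. line_ker p (axis k 1) w * sin (2 * pi * norm \<xi> * (w $ k)) \<partial>lborel))"
proof -
  let ?e = "axis k 1 :: real^'n" and ?r = "2 * pi * norm \<xi>"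
  let ?F = "fourier (\<lambda>z::real^'n. tail_ker p z) \<xi>"
  have pm[measurable]: "p \<in> borel_measurable borel" by (rule L1_profile_measurable[OF p])
  obtain T where T: "orthogonal_transformation T" "T (norm \<xi> *\<^sub>R ?e) = \<xi>"
    by (rule orthogonal_transformation_exists[of "norm \<xi> *\<^sub>R ?e" \<xi>]) simp
  note [measurable] = orthogonal_transformation_borel_measurable[OF T(1)]
  have Tin: "T x \<bullet> \<xi> = norm \<xi> * x $ k" for x
  proof -
    have "T x \<bullet> \<xi> = x \<bullet> (norm \<xi> *\<^sub>R ?e)"
      using T by (metis orthogonal_transformation_def)
    then show ?thesis by (simp add: inner_axis)
  qed
  define E where "E x = exp (\<i> * complex_of_real (?r * x $ k))" for x :: "real^'n"
  have [measurable]: "E \<in> borel_measurable borel"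
    unfolding E_def by (intro borel_measurable_continuous_onI continuous_intros)
  have "?F = (\<integral>x. tail_ker p x *\<^sub>R fourier_char \<xi> x \<partial>distr lborel borel T)"
    by (simp add: fourier_tail lborel_distr_orthogonal[OF T(1)])
  also have "\<dots> = (\<integral>x. tail_ker p (T x) *\<^sub>R fourier_char \<xi> (T x) \<partial>lborel)"
    by (rule integral_distr) measurable
  also have "\<dots> = (\<integral>x. tail_ker p x *\<^sub>R E x \<partial>lborel)"
    by (simp add: orthogonal_transformation_norm[OF T(1)] fourier_char_def Tin E_def mult.assoc)
  finally have F1: "?F = (\<integral>x. tail_ker p x *\<^sub>R E x \<partial>lborel)" .
  then have F2: "?F = (\<integral>x. tail_ker p x *\<^sub>R E (- x) \<partial>lborel)"
    using integral_lborel_uminus[of "\<lambda>x. tail_ker p x *\<^sub>R E x"] by simp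
  have int: "integrable lborel (\<lambda>x. tail_ker p x *\<^sub>R E (c *\<^sub>R x))" for c
  proof (rule Bochner_Integration.integrable_bound[OF tail_integrable[OF p]])
    show "AE x in lborel. norm (tail_ker p x *\<^sub>R E (c *\<^sub>R x)) \<le> norm (tail_ker p x)"
      unfolding E_def by (simp only: norm_scaleR norm_exp_i_times) simp
  qed measurable
  have "2 * ?F = (\<integral>x. tail_ker p x *\<^sub>R E x + tail_ker p x *\<^sub>R E (- x) \<partial>lborel)"
    using Bochner_Integration.integral_add[OF int[of 1] int[of "-1"]] F1 F2 by simp
  also have "\<dots> = (\<integral>x. complex_of_real (2 * (tail_ker p x *\<^sub>R cos (?r * x $ k))) \<partial>lborel)"
  proof (rule Bochner_Integration.integral_cong[OF refl])
    fix x :: "real^'n"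
    have "E x + E (- x) = 2 * complex_of_real (cos (?r * x $ k))"
      by (simp add: E_def complex_eq_iff Re_exp Im_exp)
    then show "tail_ker p x *\<^sub>R E x + tail_ker p x *\<^sub>R E (- x) = complex_of_real (2 * (tail_ker p x *\<^sub>R cos (?r * x $ k)))"
      by (simp add: scaleR_conv_of_real flip: distrib_left)
  qed
  also have "\<dots> = 2 * complex_of_real (\<integral>x. tail_ker p x *\<^sub>R cos (?r * x $ k) \<partial>lborel)"
    by (subst integral_complex_of_real) (simp only: integral_mult_right_zero of_real_mult of_real_numeral)
  also have "(\<integral>x. tail_ker p x *\<^sub>R cos (?r * x $ k) \<partial>lborel)
      = (\<integral>w. line_ker p ?e w *\<^sub>R (sin (?r * w $ k) / ?r - sin (?r * (0::real^'n) $ k) / ?r) \<partial>lborel)"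
  proof (rule kernel_integral_by_parts_bounded(2)[OF p, of ?e "\<lambda>x. cos (?r * x $ k)" "\<lambda>x. sin (?r * x $ k) / ?r" 1])
    show "((\<lambda>s. sin (?r * (a + s *\<^sub>R ?e) $ k) / ?r) has_vector_derivative cos (?r * (a + s *\<^sub>R ?e) $ k)) (at s)" for a s
      unfolding has_real_derivative_iff_has_vector_derivative[symmetric]
      using \<xi> by (auto intro!: derivative_eq_intros)
    show "norm (sin (?r * w $ k) / ?r - sin (?r * (0::real^'n) $ k) / ?r) \<le> 1 * norm w" for w
    proof -
      have "\<bar>sin (?r * w $ k)\<bar> \<le> \<bar>?r * w $ k\<bar>" by (rule abs_sin_x_le_abs_x)
      also have "\<dots> \<le> ?r * norm w"
        using component_le_norm_cart[of w k] by (simp add: abs_mult mult_left_mono)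
      finally show ?thesis using \<xi> by (simp add: abs_divide field_simps)
    qed
  qed (auto intro!: continuous_intros simp: \<xi>)
  also have "\<dots> = (\<integral>w. (1 / ?r) * (line_ker p ?e w * sin (?r * w $ k)) \<partial>lborel)"
    by (simp add: field_simps)
  also have "\<dots> = (1 / ?r) * (\<integral>w. line_ker p ?e w * sin (?r * w $ k) \<partial>lborel)"
    by (rule integral_mult_right_zero)
  finally show ?thesis by (subst (asm) mult_cancel_left) simp
qed

text \<open>The increment \<open>u x - u (x - w)\<close> is at most \<open>C min 1 |w|\<close> and vanishes unless \<open>x\<close> or \<open>x - w\<close> lies in the
  support of \<open>u\<close>, so integrating over \<open>x\<close> first costs only twice the volume of a ball.\<close>
lemma kernel_increment_integrable:
  fixes u :: "real^'n \<Rightarrow> real"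
  assumes p: "admissible TYPE(real^'n) p" and u: "C_inf u" and R: "zero_outside R u" and e: "norm e = 1"
  shows "integrable (lborel \<Otimes>\<^sub>M lborel) (\<lambda>(x, w). line_ker p e w * (u x - u (x - w)))"
proof (rule integrableI_bounded)
  have [measurable]: "p \<in> borel_measurable borel" using p by measurable
  have [measurable]: "u \<in> borel_measurable borel"
    by (rule borel_measurable_continuous_onI[OF C_inf_continuous[OF u]])
  obtain C where C: "0 \<le> C" "\<And>a b. \<bar>u a - u b\<bar> \<le> C * min 1 (norm (a - b))"
    using smooth_increment_bound[OF u R] by metis
  let ?B = "cball 0 R :: (real^'n) set"
  define V where "V = measure lborel ?B"
  have V: "emeasure lborel ?B = ennreal V" "0 \<le> V"
    using emeasure_bounded_finite[of ?B] by (simp_all add: V_def emeasure_eq_ennreal_measure)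
  have [measurable]: "?B \<in> sets borel" by simp
  show "(\<lambda>(x, w). line_ker p e w * (u x - u (x - w))) \<in> borel_measurable (lborel \<Otimes>\<^sub>M lborel)"
    by measurable
  have "(\<integral>\<^sup>+z. ennreal (norm (case z of (x, w) \<Rightarrow> line_ker p e w * (u x - u (x - w)))) \<partial>(lborel \<Otimes>\<^sub>M lborel))
      = (\<integral>\<^sup>+w. \<integral>\<^sup>+x. ennreal \<bar>line_ker p e w * (u x - u (x - w))\<bar> \<partial>lborel \<partial>lborel)"
    by (subst lborel_pair.nn_integral_snd[symmetric]) auto
  also have "\<dots> \<le> (\<integral>\<^sup>+w. ennreal (p (norm w) / norm w * (2 * V * C * min 1 (norm w))) \<partial>(lborel :: (real^'n) measure))"
  proof (intro nn_integral_mono)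
    fix w :: "real^'n"
    let ?m = "p (norm w) / norm w * (C * min 1 (norm w))"
    have m: "0 \<le> ?m" using C(1) admissible_nonneg[OF p] by simp
    have pt: "ennreal \<bar>line_ker p e w * (u x - u (x - w))\<bar>
        \<le> ennreal ?m * (indicator ?B x + indicator ?B (- w + x))" for x
    proof (cases "x \<in> ?B \<or> x - w \<in> ?B")
      case True
      have "\<bar>line_ker p e w * (u x - u (x - w))\<bar> \<le> ?m"
        unfolding abs_mult using abs_line_ker_le[of e p w] admissible_nonneg[OF p] e C(2)[of x "x - w"] C(1)
        by (intro mult_mono) auto
      then have "ennreal \<bar>line_ker p e w * (u x - u (x - w))\<bar> \<le> ennreal ?m * 1"
        by (simp add: ennreal_leI)
      also have "\<dots> \<le> ennreal ?m * (indicator ?B x + indicator ?B (- w + x))"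
        using True by (intro mult_left_mono) (auto simp: indicator_def)
      finally show ?thesis .
    next
      case False
      then have "u x = 0" "u (x - w) = 0" by (auto intro!: zero_outsideD[OF R])
      then show ?thesis by simp
    qed
    have "(\<integral>\<^sup>+x. ennreal \<bar>line_ker p e w * (u x - u (x - w))\<bar> \<partial>lborel)
        \<le> (\<integral>\<^sup>+x. ennreal ?m * (indicator ?B x + indicator ?B (- w + x)) \<partial>lborel)"
      by (intro nn_integral_mono pt)
    also have "\<dots> = ennreal ?m * ((\<integral>\<^sup>+x. indicator ?B x \<partial>lborel) + (\<integral>\<^sup>+x. indicator ?B (- w + x) \<partial>lborel))"
      by (simp add: nn_integral_cmult nn_integral_add)
    also have "(\<integral>\<^sup>+x. indicator ?B (- w + x) \<partial>lborel) = (\<integral>\<^sup>+x. indicator ?B x \<partial>lborel)"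
      by (rule nn_integral_lborel_translate) measurable
    also have "ennreal ?m * ((\<integral>\<^sup>+x. indicator ?B x \<partial>lborel) + (\<integral>\<^sup>+x. indicator ?B x \<partial>lborel))
        = ennreal (p (norm w) / norm w * (2 * V * C * min 1 (norm w)))"
      using V m by (simp add: algebra_simps flip: ennreal_plus ennreal_mult')
    finally show "(\<integral>\<^sup>+x. ennreal \<bar>line_ker p e w * (u x - u (x - w))\<bar> \<partial>lborel)
        \<le> ennreal (p (norm w) / norm w * (2 * V * C * min 1 (norm w)))" .
  qed
  also have "\<dots> < \<infinity>" using V C by (intro admissible_finite[OF p]) auto
  finally show "(\<integral>\<^sup>+z. ennreal (norm (case z of (x, w) \<Rightarrow> line_ker p e w * (u x - u (x - w)))) \<partial>(lborel \<Otimes>\<^sub>M lborel)) < \<infinity>" .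
qed

text \<open>After exchanging the integrals, the transform of \<open>x \<mapsto> u x - u (x - w)\<close> is the transform of \<open>u\<close> times
  \<open>1 - exp (- 2 \<pi> i \<xi> \<bullet> w)\<close>; since \<open>K\<close> is odd, replacing \<open>w\<close> by \<open>- w\<close> yields the stated symbol.\<close>
lemma fourier_kernel_increment:
  fixes u :: "real^'n \<Rightarrow> real"
  assumes p: "admissible TYPE(real^'n) p" and u: "C_inf u" and R: "zero_outside R u" and e: "norm e = 1"
  defines "g \<equiv> \<lambda>x. (\<integral>w. line_ker p e w * (u x - u (x - w)) \<partial>lborel)"
  shows "integrable lborel g"
    and "(\<integral>x. g x *\<^sub>R fourier_char \<xi> (- x) \<partial>lborel)
      = fourier u \<xi> * (\<integral>w. line_ker p e w *\<^sub>R (fourier_char \<xi> w - 1) \<partial>lborel)"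
proof -
  have [measurable]: "p \<in> borel_measurable borel" using p by measurable
  have cu: "continuous_on UNIV u" by (rule C_inf_continuous[OF u])
  have [measurable]: "u \<in> borel_measurable borel" by (rule borel_measurable_continuous_onI[OF cu])
  note int = kernel_increment_integrable[OF p u R e]
  show "integrable lborel g"
    unfolding g_def using lborel_pair.integrable_fst'[OF int] by simp
  define F where "F x w = (line_ker p e w * (u x - u (x - w))) *\<^sub>R fourier_char \<xi> (- x)" for x w
  have intF: "integrable (lborel \<Otimes>\<^sub>M lborel) (case_prod F)"
  proof (rule Bochner_Integration.integrable_bound[OF int])
    show "AE z in lborel \<Otimes>\<^sub>M lborel. norm (case_prod F z)
        \<le> norm (case z of (x, w) \<Rightarrow> line_ker p e w * (u x - u (x - w)))"
      by (auto simp: F_def)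
    show "case_prod F \<in> borel_measurable (lborel \<Otimes>\<^sub>M lborel)"
      unfolding F_def by measurable
  qed
  have intu: "integrable lborel (\<lambda>x. u x *\<^sub>R fourier_char \<xi> (- x))"
  proof -
    have "integrable lborel (\<lambda>x. indicator (cball 0 R) x *\<^sub>R (u x *\<^sub>R fourier_char \<xi> (- x)))"
      by (intro borel_integrable_compact compact_cball continuous_intros continuous_on_subset[OF cu]
          continuous_on_compose2[OF continuous_on_fourier_char[of UNIV]]) auto
    also have "(\<lambda>x. indicator (cball 0 R) x *\<^sub>R (u x *\<^sub>R fourier_char \<xi> (- x))) = (\<lambda>x. u x *\<^sub>R fourier_char \<xi> (- x))"
      using zero_outsideD[OF R] by (force simp: indicator_def fun_eq_iff)
    finally show ?thesis .
  qed
  have fu: "fourier u \<xi> = (\<integral>x. u x *\<^sub>R fourier_char \<xi> (- x) \<partial>lborel)"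
    by (rule fourier_eq_fourier_char) measurable
  have shift: "integrable lborel (\<lambda>x. u (x - w) *\<^sub>R fourier_char \<xi> (- x))"
    "(\<integral>x. u (x - w) *\<^sub>R fourier_char \<xi> (- x) \<partial>lborel) = fourier_char \<xi> (- w) * fourier u \<xi>" for w
  proof -
    let ?f = "\<lambda>x. u (x - w) *\<^sub>R fourier_char \<xi> (- x)"
    have eq: "?f (w + x) = fourier_char \<xi> (- w) * (u x *\<^sub>R fourier_char \<xi> (- x))" for x
      using fourier_char_add[of \<xi> "- w" "- x"] by simp
    have "integrable lborel (\<lambda>x. ?f (w + x))"
      unfolding eq by (intro integrable_mult_right intu)
    then have "integrable (distr lborel borel ((+) w)) ?f"
      by (subst integrable_distr_eq) auto
    then show "integrable lborel ?f" by (simp only: lborel_distr_plus)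
    have "(\<integral>x. ?f x \<partial>lborel) = (\<integral>x. ?f x \<partial>distr lborel borel ((+) w))"
      by (simp only: lborel_distr_plus)
    also have "\<dots> = (\<integral>x. ?f (w + x) \<partial>lborel)" by (rule integral_distr) measurable
    also have "\<dots> = fourier_char \<xi> (- w) * fourier u \<xi>"
      unfolding eq fu by (rule integral_mult_right_zero)
    finally show "(\<integral>x. ?f x \<partial>lborel) = fourier_char \<xi> (- w) * fourier u \<xi>" .
  qed
  have inner: "(\<integral>x. F x w \<partial>lborel) = fourier u \<xi> * (line_ker p e w *\<^sub>R (1 - fourier_char \<xi> (- w)))" for w
  proof -
    have "(\<integral>x. F x w \<partial>lborel) = (\<integral>x. line_ker p e w *\<^sub>R (u x *\<^sub>R fourier_char \<xi> (- x) - u (x - w) *\<^sub>R fourier_char \<xi> (- x)) \<partial>lborel)"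
      by (simp add: F_def scaleR_diff_left right_diff_distrib scaleR_diff_right)
    also have "\<dots> = line_ker p e w *\<^sub>R (fourier u \<xi> - fourier_char \<xi> (- w) * fourier u \<xi>)"
      by (simp add: Bochner_Integration.integral_diff[OF intu shift(1)] shift(2) fourier_eq_fourier_char)
    finally show ?thesis by (simp add: algebra_simps)
  qed
  have "(\<integral>x. g x *\<^sub>R fourier_char \<xi> (- x) \<partial>lborel) = (\<integral>x. \<integral>w. F x w \<partial>lborel \<partial>lborel)"
  proof (rule integral_cong_AE)
    have "AE x in lborel. integrable lborel (\<lambda>w. line_ker p e w * (u x - u (x - w)))"
      using lborel_pair.AE_integrable_fst'[OF int] by simp
    then show "AE x in lborel. g x *\<^sub>R fourier_char \<xi> (- x) = (\<integral>w. F x w \<partial>lborel)"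
      by eventually_elim (simp add: g_def F_def)
    show "(\<lambda>x. g x *\<^sub>R fourier_char \<xi> (- x)) \<in> borel_measurable lborel"
      unfolding g_def by measurable
    show "(\<lambda>x. \<integral>w. F x w \<partial>lborel) \<in> borel_measurable lborel"
      unfolding F_def by measurable
  qed
  also have "\<dots> = (\<integral>w. \<integral>x. F x w \<partial>lborel \<partial>lborel)"
    by (rule lborel_pair.Fubini_integral[OF intF, symmetric])
  also have "\<dots> = fourier u \<xi> * (\<integral>w. line_ker p e w *\<^sub>R (1 - fourier_char \<xi> (- w)) \<partial>lborel)"
    unfolding inner by (rule integral_mult_right_zero)
  also have "(\<integral>w. line_ker p e w *\<^sub>R (1 - fourier_char \<xi> (- w)) \<partial>lborel)
      = (\<integral>w. line_ker p e (- w) *\<^sub>R (1 - fourier_char \<xi> (- (- w))) \<partial>lborel)"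
    by (rule integral_lborel_uminus[symmetric]) measurable
  also have "\<dots> = (\<integral>w. line_ker p e w *\<^sub>R (fourier_char \<xi> w - 1) \<partial>lborel)"
    by (simp add: line_ker_def algebra_simps)
  finally show "(\<integral>x. g x *\<^sub>R fourier_char \<xi> (- x) \<partial>lborel)
      = fourier u \<xi> * (\<integral>w. line_ker p e w *\<^sub>R (fourier_char \<xi> w - 1) \<partial>lborel)" .
qed

section \<open>Passage to a Borel profile\<close>

text \<open>Integrals with respect to the completed measure are computed from a Borel representative; completeness makes
  \<open>f\<close> measurable.\<close>
lemma lebesgue_integral_eq_lborel:
  fixes f g :: "'a::euclidean_space \<Rightarrow> 'b::euclidean_space"
  assumes ae: "AE x in lborel. f x = g x" and g: "g \<in> borel_measurable borel"
  shows "integrable lebesgue f \<longleftrightarrow> integrable lborel g" "(\<integral>x. f x \<partial>lebesgue) = (\<integral>x. g x \<partial>lborel)"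
proof -
  have g': "g \<in> borel_measurable lborel" using g by simp
  then have gl: "g \<in> borel_measurable lebesgue" by (rule measurable_completion)
  have ae': "AE x in lebesgue. g x = f x"
    using AE_completion[OF ae] by eventually_elim simp
  then have fl: "f \<in> borel_measurable lebesgue" by (rule borel_measurable_AE[OF gl])
  have "integrable lebesgue f \<longleftrightarrow> integrable lebesgue g"
    using ae' by (intro integrable_cong_AE fl gl) (auto elim: eventually_mono)
  then show "integrable lebesgue f \<longleftrightarrow> integrable lborel g"
    by (simp add: integrable_completion[OF g'])
  have "(\<integral>x. f x \<partial>lebesgue) = (\<integral>x. g x \<partial>lebesgue)"
    using ae' by (intro integral_cong_AE fl gl) (auto elim: eventually_mono)
  then show "(\<integral>x. f x \<partial>lebesgue) = (\<integral>x. g x \<partial>lborel)"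
    by (simp add: integral_completion[OF g'])
qed

lemma vec_eq_sum_axis:
  fixes x :: "'b::euclidean_space^'n"
  shows "x = (\<Sum>j\<in>UNIV. axis j (x $ j))"
  by (simp add: vec_eq_iff axis_def)

lemma
  fixes F :: "'a \<Rightarrow> 'b::euclidean_space^'n"
  assumes int: "\<And>j. integrable M (\<lambda>x. F x $ j)"
  shows integrable_vec: "integrable M F"
    and integral_vec_nth: "(\<integral>x. F x \<partial>M) $ j = (\<integral>x. F x $ j \<partial>M)"
proof -
  have bl: "bounded_linear (axis j :: 'b \<Rightarrow> 'b^'n)" for j
    by (intro linear_conv_bounded_linear[THEN iffD1] linearI) (auto simp: axis_def vec_eq_iff)
  have "integrable M (\<lambda>x. \<Sum>j\<in>UNIV. axis j (F x $ j))"
    by (intro Bochner_Integration.integrable_sum integrable_bounded_linear[OF bl] int)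
  then show F: "integrable M F" by (simp flip: vec_eq_sum_axis)
  show "(\<integral>x. F x \<partial>M) $ j = (\<integral>x. F x $ j \<partial>M)"
    by (rule integral_bounded_linear[OF bounded_linear_vec_nth F, symmetric])
qed

lemma conv_vec_nth:
  fixes f :: "real^'n \<Rightarrow> real^'m"
  assumes Q[measurable]: "Q \<in> borel_measurable borel"
    and loc: "\<And>r. integrable lborel (\<lambda>z. indicator (cball 0 r) z * Q z)"
    and f: "\<And>j. continuous_on UNIV (\<lambda>x. f x $ j)" and R: "\<And>j. zero_outside R (\<lambda>x. f x $ j)"
  shows "conv Q f x $ j = conv Q (\<lambda>y. f y $ j) x"
proof -
  have "continuous_on UNIV (\<lambda>x. \<chi> j. f x $ j)"
    by (intro continuous_on_vec_lambda f)
  then have [measurable]: "f \<in> borel_measurable borel"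
    by (intro borel_measurable_continuous_onI) simp
  have "integrable lborel (\<lambda>z. (Q z *\<^sub>R f (x - z)) $ j)" for j
    using conv_integrable[OF Q loc f R] by simp
  then have "(\<integral>z. Q z *\<^sub>R f (x - z) \<partial>lborel) $ j = (\<integral>z. (Q z *\<^sub>R f (x - z)) $ j \<partial>lborel)"
    by (rule integral_vec_nth)
  moreover have "(\<lambda>y. f y $ j) \<in> borel_measurable borel"
    by (rule borel_measurable_continuous_onI[OF f])
  ultimately show ?thesis by (simp add: conv_eq_lborel)
qed

lemma C_inf_c_zero_outside:
  assumes "C_inf_c u"
  obtains R where "zero_outside R u"
proof -
  have "bounded (closure {x. u x \<noteq> 0})"
    using assms by (simp add: C_inf_c_def compact_imp_bounded)
  then have "bounded {x. u x \<noteq> 0}" using bounded_subset closure_subset by blast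
  then obtain R where "\<And>x. u x \<noteq> 0 \<Longrightarrow> norm x \<le> R" by (auto simp: bounded_iff)
  then have "zero_outside R u" by (force simp: zero_outside_def)
  then show thesis by (rule that)
qed

text \<open>The kernel \<open>\<rho>\<close> and its radial representation \<open>\<rho>b\<close> are tied to a Borel profile \<open>p\<close> by
  separate almost everywhere statements, on the space and on the half line, because no pointwise relation survives the
  passage to \<open>p\<close>.\<close>
locale radial_kernel =
  fixes \<rho> :: "real^'n \<Rightarrow> ennreal" and \<rho>b :: "real \<Rightarrow> ennreal" and p :: "real \<Rightarrow> real"
  assumes p: "admissible TYPE(real^'n) p"
    and p\<rho>: "AE x in lborel. enn2real (\<rho> x) = p (norm x)"
    and p\<rho>b: "AE t in lborel. 0 < t \<longrightarrow> p t = enn2real (\<rho>b t)"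
begin

lemma pm [measurable]: "p \<in> borel_measurable borel"
  using p by measurable

text \<open>A changed value of the profile on a null set of radii does not affect the tail, so the equality holds at every point \<open>z\<close>.\<close>
lemma Q_ker_eq: "Q_ker \<rho>b (z :: real^'n) = tail_ker p z"
proof -
  have "Q_ker \<rho>b z = (\<integral>t. indicator {norm z<..} t *\<^sub>R (p t / t) \<partial>lborel)"
    unfolding Q_ker_def set_lebesgue_integral_def
  proof (rule lebesgue_integral_eq_lborel(2))
    show "AE t in lborel. indicator {norm z<..} t *\<^sub>R (enn2real (\<rho>b t) / t) = indicator {norm z<..} t *\<^sub>R (p t / t)"
      using p\<rho>b by eventually_elim (auto simp: indicator_def dest: le_less_trans[OF norm_ge_zero])
  qed measurable
  also have "\<dots> = enn2real (\<integral>\<^sup>+t. ennreal (indicator {norm z<..} t *\<^sub>R (p t / t)) \<partial>lborel)"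
  proof (rule integral_eq_nn_integral)
    show "AE t in lborel. 0 \<le> indicator {norm z<..} t *\<^sub>R (p t / t)"
      using admissible_nonneg[OF p]
      by (intro AE_I2) (auto simp: indicator_def zero_le_divide_iff dest: le_less_trans[OF norm_ge_zero])
  qed measurable
  also have "(\<integral>\<^sup>+t. ennreal (indicator {norm z<..} t *\<^sub>R (p t / t)) \<partial>lborel) = tail p (norm z)"
    unfolding tail_def by (intro nn_integral_cong) (auto simp: indicator_def)
  finally show ?thesis .
qed

lemma Q_ker_eq': "Q_ker \<rho>b = (\<lambda>z :: real^'n. tail_ker p z)"
  by (rule ext) (rule Q_ker_eq)

text \<open>The substitution \<open>y = x - w\<close> brings the definition into the form produced by the integration by parts.\<close>
lemma nl_grad_component:
  fixes u :: "real^'n \<Rightarrow> real"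
  assumes u: "C_inf u" and R: "zero_outside R u"
  shows "nl_grad \<rho> u x $ j = (\<integral>w. line_ker p (axis j 1) w * (u x - u (x - w)) \<partial>lborel)"
proof -
  have [measurable]: "u \<in> borel_measurable borel"
    by (rule borel_measurable_continuous_onI[OF C_inf_continuous[OF u]])
  define G where "G w = (p (norm w) / (norm w)\<^sup>2 * (u x - u (x - w))) *\<^sub>R w" for w :: "real^'n"
  have [measurable]: "G \<in> borel_measurable borel" unfolding G_def by measurable
  have Gj: "G w $ j = line_ker p (axis j 1) w * (u x - u (x - w))" for w j
    by (simp add: G_def line_ker_def inner_axis)
  have "AE y in distr lborel borel (\<lambda>y. x - y). enn2real (\<rho> y) = p (norm y)"
    unfolding lborel_distr_reflect by (rule p\<rho>)
  then have ae: "AE y in lborel. enn2real (\<rho> (x - y)) = p (norm (x - y))"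
    by (rule AE_distrD[rotated]) simp
  have "nl_grad \<rho> u x = (\<integral>y. G (x - y) \<partial>lborel)"
    unfolding nl_grad_def
  proof (rule lebesgue_integral_eq_lborel(2))
    show "AE y in lborel. ((u x - u y) / norm (x - y)) *\<^sub>R
        (enn2real (\<rho> (x - y)) *\<^sub>R ((x - y) /\<^sub>R norm (x - y))) = G (x - y)"
      using ae by eventually_elim (simp add: G_def power2_eq_square divide_inverse mult_ac)
  qed measurable
  also have "\<dots> = (\<integral>w. G w \<partial>distr lborel borel (\<lambda>y. x - y))"
    by (rule integral_distr[symmetric]) simp_all
  also have "\<dots> = (\<integral>w. G w \<partial>lborel)" by (simp only: lborel_distr_reflect)
  finally have "nl_grad \<rho> u x $ j = (\<integral>w. G w $ j \<partial>lborel)"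
    using conv_tail_partial(1)[OF p u R, of _ x] by (simp add: integral_vec_nth Gj)
  then show ?thesis by (simp add: Gj)
qed

lemma nl_grad_component_conv:
  fixes u :: "real^'n \<Rightarrow> real"
  assumes u: "C_inf u" and R: "zero_outside R u"
  shows "nl_grad \<rho> u x $ j = conv (Q_ker \<rho>b) (partial_deriv j u) x"
  unfolding nl_grad_component[OF u R] Q_ker_eq' conv_tail_partial(2)[OF p u R] ..

lemma Q_ker_measurable: "(Q_ker \<rho>b :: real^'n \<Rightarrow> real) \<in> borel_measurable borel"
  unfolding Q_ker_eq' by measurable

lemma Q_ker_locally_integrable:
  "integrable lborel (\<lambda>z :: real^'n. indicator (cball 0 r) z * Q_ker \<rho>b z)"
  unfolding Q_ker_eq' by (rule tail_locally_integrable[OF p])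

text \<open>Component \<open>j\<close> of the nonlocal gradient is the convolution of the tail kernel with the \<open>j\<close>-th partial
  derivative of \<open>u\<close>, and the remaining claims are properties of convolutions.\<close>
lemma nl_grad_representation:
  fixes u :: "real^'n \<Rightarrow> real"
  assumes "C_inf_c u"
  shows "C_inf (nl_grad \<rho> u)" "nl_grad \<rho> u = conv (Q_ker \<rho>b) (grad u)"
    "conv (Q_ker \<rho>b) u differentiable (at x)" "nl_grad \<rho> u = grad (conv (Q_ker \<rho>b) u)"
proof -
  have u: "C_inf u" using assms by (simp add: C_inf_c_def)
  obtain R where R: "zero_outside R u" by (rule C_inf_c_zero_outside[OF assms])
  note Q = Q_ker_measurable Q_ker_locally_integrable
  have "C_inf (\<lambda>x. nl_grad \<rho> u x $ j)" for j
    unfolding nl_grad_component_conv[OF u R]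
    by (rule conv_C_inf[OF Q C_inf_partial[OF u] zero_outside_partial[OF R]])
  then show "C_inf (nl_grad \<rho> u)"
    unfolding C_inf_def by (intro allI C_diff_vec) blast
  have "conv (Q_ker \<rho>b) (grad u) x $ j = conv (Q_ker \<rho>b) (partial_deriv j u) x" for x j
    using conv_vec_nth[OF Q, of "grad u" R x j] C_inf_continuous[OF C_inf_partial[OF u]]
      zero_outside_partial[OF R] by (simp add: grad_def)
  then show "nl_grad \<rho> u = conv (Q_ker \<rho>b) (grad u)"
    by (simp add: fun_eq_iff vec_eq_iff nl_grad_component_conv[OF u R])
  show "conv (Q_ker \<rho>b) u differentiable (at x)"
    by (rule conv_partial(1)[OF Q u R])
  show "nl_grad \<rho> u = grad (conv (Q_ker \<rho>b) u)"
    by (simp add: fun_eq_iff vec_eq_iff nl_grad_component_conv[OF u R] grad_def conv_partial(2)[OF Q u R])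
qed

lemma lam_eq:
  assumes L1: "L1_profile TYPE(real^'n) p"
  shows "lam \<rho> \<xi> = (2 * pi * \<i> * fourier (Q_ker \<rho>b) \<xi>) *s cvec \<xi>"
proof -
  define G where "G x = (fourier_char \<xi> x - 1) *s cvec ((p (norm x) / (norm x)\<^sup>2) *\<^sub>R x)" for x
  have Gj: "G x $ j = line_ker p (axis j 1) x *\<^sub>R (fourier_char \<xi> x - 1)" for x j
    by (simp add: G_def cvec_def line_ker_def inner_axis) (simp add: scaleR_conv_of_real algebra_simps diff_divide_distrib)
  have int: "integrable lborel (\<lambda>x. G x $ j)" for j
    unfolding Gj by (rule fourier_tail_component(1)[OF L1])
  have "lam \<rho> \<xi> = (\<integral>x. G x \<partial>lborel)"
    unfolding lam_def
  proof (rule lebesgue_integral_eq_lborel(2))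
    show "AE x in lborel. (exp (2 * pi * \<i> * complex_of_real (\<xi> \<bullet> x)) - 1) *s
        cvec ((enn2real (\<rho> x) / (norm x)\<^sup>2) *\<^sub>R x) = G x"
      using p\<rho> by eventually_elim (simp add: G_def fourier_char_def inner_commute mult_ac)
    show "G \<in> borel_measurable borel"
      using borel_measurable_integrable[OF integrable_vec[OF int]] by simp
  qed
  then show ?thesis
    unfolding vec_eq_iff
    by (simp add: integral_vec_nth[OF int] Gj fourier_tail_component(2)[OF L1] Q_ker_eq' cvec_def)
qed

lemma fourier_nl_grad:
  fixes u :: "real^'n \<Rightarrow> real"
  assumes L1: "L1_profile TYPE(real^'n) p" and "C_inf_c u"
  shows "integrable lebesgue (nl_grad \<rho> u)"
    and "fourier_vec (nl_grad \<rho> u) \<xi> = (2 * pi * \<i> * fourier (Q_ker \<rho>b) \<xi> * fourier u \<xi>) *s cvec \<xi>"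
proof -
  have u: "C_inf u" using assms by (simp add: C_inf_c_def)
  obtain R where R: "zero_outside R u" by (rule C_inf_c_zero_outside[OF assms(2)])
  have e: "norm (axis j 1 :: real^'n) = 1" for j :: 'n by simp
  have int: "integrable lborel (\<lambda>x. nl_grad \<rho> u x $ j)" for j
    unfolding nl_grad_component[OF u R] by (rule fourier_kernel_increment(1)[OF p u R e])
  have "integrable lborel (nl_grad \<rho> u)" by (rule integrable_vec[OF int])
  then show "integrable lebesgue (nl_grad \<rho> u)"
    by (simp add: integrable_completion borel_measurable_integrable)
  have "fourier (\<lambda>x. nl_grad \<rho> u x $ j) \<xi> = 2 * pi * \<i> * fourier (Q_ker \<rho>b) \<xi> * fourier u \<xi> * complex_of_real (\<xi> $ j)" for j
  proof -
    have "(\<lambda>x. nl_grad \<rho> u x $ j) \<in> borel_measurable borel"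
      using borel_measurable_integrable[OF int] by simp
    then have "fourier (\<lambda>x. nl_grad \<rho> u x $ j) \<xi> = (\<integral>x. nl_grad \<rho> u x $ j *\<^sub>R fourier_char \<xi> (- x) \<partial>lborel)"
      by (rule fourier_eq_fourier_char)
    also have "\<dots> = fourier u \<xi> * (\<integral>w. line_ker p (axis j 1) w *\<^sub>R (fourier_char \<xi> w - 1) \<partial>lborel)"
      unfolding nl_grad_component[OF u R] by (rule fourier_kernel_increment(2)[OF p u R e])
    finally show ?thesis
      by (simp add: fourier_tail_component(2)[OF L1] Q_ker_eq')
  qed
  then show "fourier_vec (nl_grad \<rho> u) \<xi> = (2 * pi * \<i> * fourier (Q_ker \<rho>b) \<xi> * fourier u \<xi>) *s cvec \<xi>"
    by (simp add: fourier_vec_def vec_eq_iff cvec_def)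
qed

lemma fourier_Q_ker:
  fixes \<xi> :: "real^'n" and k :: 'n
  assumes L1: "L1_profile TYPE(real^'n) p" and \<xi>: "\<xi> \<noteq> 0"
  shows "fourier (Q_ker \<rho>b) \<xi> = complex_of_real (1 / (2 * pi * norm \<xi>) *
    (LINT x|lebesgue. enn2real (\<rho> x) * (x $ k) / (norm x)\<^sup>2 * sin (2 * pi * norm \<xi> * (x $ k))))"
proof -
  have "(LINT x|lebesgue. enn2real (\<rho> x) * (x $ k) / (norm x)\<^sup>2 * sin (2 * pi * norm \<xi> * (x $ k)))
      = (\<integral>x. line_ker p (axis k 1) x * sin (2 * pi * norm \<xi> * (x $ k)) \<partial>lborel)"
  proof (rule lebesgue_integral_eq_lborel(2))
    show "AE x in lborel. enn2real (\<rho> x) * (x $ k) / (norm x)\<^sup>2 * sin (2 * pi * norm \<xi> * (x $ k))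
        = line_ker p (axis k 1) x * sin (2 * pi * norm \<xi> * (x $ k))"
      using p\<rho> by eventually_elim (simp add: line_ker_def inner_axis)
    have [measurable]: "(\<lambda>x. sin (2 * pi * norm \<xi> * (x $ k))) \<in> borel_measurable borel"
      by (intro borel_measurable_continuous_onI continuous_intros)
    show "(\<lambda>x. line_ker p (axis k 1) x * sin (2 * pi * norm \<xi> * (x $ k))) \<in> borel_measurable borel"
      by measurable
  qed
  then show ?thesis
    unfolding Q_ker_eq' fourier_tail_radial[OF L1 \<xi>, of k] by simp
qed

end

theorem proposition2p6:
  fixes \<rho> :: "real^'n \<Rightarrow> ennreal" and \<rho>b :: "real \<Rightarrow> ennreal"
  assumes radial: "radial_rep \<rho> \<rho>b"
    and finite_off_0: "\<And>x. x \<noteq> 0 \<Longrightarrow> \<rho> x < \<infinity>"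
    and loc_integrable: "L1_loc \<rho>"
    and min_integrable: "(\<integral>\<^sup>+x. ennreal (min 1 (1 / norm x)) * \<rho> x \<partial>lebesgue) < \<infinity>"
    and pos_near_0: "\<exists>\<epsilon>>0. (INF x\<in>ball 0 \<epsilon>. \<rho> x) > 0"
  shows
    "(\<forall>u. C_inf_c u \<longrightarrow>
        C_inf (nl_grad \<rho> u) \<and>
        nl_grad \<rho> u = conv (Q_ker \<rho>b) (grad u) \<and>
        (\<forall>x. conv (Q_ker \<rho>b) u differentiable (at x)) \<and>
        nl_grad \<rho> u = grad (conv (Q_ker \<rho>b) u))
     \<and>
     (L1 \<rho> \<longrightarrow>
        (\<forall>u. C_inf_c u \<longrightarrow>
           integrable lebesgue (nl_grad \<rho> u) \<and>
           (\<forall>\<xi>. fourier_vec (nl_grad \<rho> u) \<xi> =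
              (2 * pi * \<i> * fourier (Q_ker \<rho>b) \<xi> * fourier u \<xi>) *s cvec \<xi>)) \<and>
        (\<forall>\<xi>::real^'n. lam \<rho> \<xi> = (2 * pi * \<i> * fourier (Q_ker \<rho>b) \<xi>) *s cvec \<xi>) \<and>
        (\<forall>(\<xi>::real^'n) (k::'n). \<xi> \<noteq> 0 \<longrightarrow>
           fourier (Q_ker \<rho>b) \<xi> =
             complex_of_real (1 / (2 * pi * norm \<xi>) *
               (LINT x|lebesgue. enn2real (\<rho> x) * (x $ k) / (norm x)\<^sup>2 *
                  sin (2 * pi * norm \<xi> * (x $ k))))))"
proof -
  have "\<rho> \<in> borel_measurable lebesgue" using loc_integrable by (simp add: L1_loc_def)
  then have "(\<lambda>x. enn2real (\<rho> x)) \<in> borel_measurable lebesgue" by measurable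
  moreover have "enn2real (\<rho> x) = enn2real (\<rho>b (norm x))" for x
    using radial by (simp add: radial_rep_def)
  ultimately obtain p where pm: "p \<in> borel_measurable borel" and p0: "\<And>t. 0 \<le> p t"
    and p\<rho>b: "AE t in lborel. 0 < t \<longrightarrow> p t = enn2real (\<rho>b t)"
    and p\<rho>: "AE x in lborel. enn2real (\<rho> x) = p (norm x)"
    by (rule radial_profile[of "\<lambda>x. enn2real (\<rho> x)" "\<lambda>t. enn2real (\<rho>b t)"]) auto
  have le: "ennreal (enn2real a) \<le> a" for a :: ennreal by (cases a) auto
  have "(\<integral>\<^sup>+w. ennreal (p (norm w) * min 1 (1 / norm w)) \<partial>(lborel :: (real^'n) measure))
      \<le> (\<integral>\<^sup>+x. ennreal (min 1 (1 / norm x)) * \<rho> x \<partial>lborel)"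
  proof (rule nn_integral_mono_AE)
    show "AE w in lborel. ennreal (p (norm w) * min 1 (1 / norm w)) \<le> ennreal (min 1 (1 / norm w)) * \<rho> w"
      using p\<rho>
    proof eventually_elim
      case (elim w)
      have "ennreal (p (norm w) * min 1 (1 / norm w)) = ennreal (min 1 (1 / norm w)) * ennreal (enn2real (\<rho> w))"
        using p0 elim by (simp add: mult.commute flip: ennreal_mult')
      also have "\<dots> \<le> ennreal (min 1 (1 / norm w)) * \<rho> w"
        by (intro mult_left_mono le) simp
      finally show ?case .
    qed
  qed
  also have "\<dots> < \<infinity>" using min_integrable by (simp add: nn_integral_completion)
  finally have "admissible TYPE(real^'n) p" using pm p0 by (simp add: admissible_def)
  then interpret radial_kernel \<rho> \<rho>b p
    using p\<rho> p\<rho>b by unfold_locales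
  have L1: "L1_profile TYPE(real^'n) p" if "L1 \<rho>"
  proof -
    have "(\<integral>\<^sup>+w. ennreal (p (norm w)) \<partial>(lborel :: (real^'n) measure)) \<le> (\<integral>\<^sup>+x. \<rho> x \<partial>lborel)"
    proof (rule nn_integral_mono_AE)
      show "AE w in lborel. ennreal (p (norm w)) \<le> \<rho> w"
        using p\<rho> by eventually_elim (metis le)
    qed
    also have "\<dots> < \<infinity>" using that by (simp add: L1_def nn_integral_completion)
    finally show ?thesis using pm p0 by (simp add: L1_profile_def)
  qed
  show ?thesis
    using nl_grad_representation fourier_nl_grad[OF L1] lam_eq[OF L1] fourier_Q_ker[OF L1] by blast
qed

end
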